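(* Fix $N\geq1$ and $w\geq0$, and put $k=w+2$. Let $P\in\bar{W}_{w}^{\Gamma_{1}(N),+}$ and define $q_{a,b}^{r,s}\in\mathbb{Q}$ for $r,s,a,b$ with $r,s\geq1$, $r+s=k$, and $(a,b)\in A(N)$ by \[ P(C_{a,-a+b})(X-Y,X)=\sum_{r,s}\frac{1}{r!s!}q_{a,b}^{r+1,s+1}X^{r}Y^{s}, \] and put \[ q_{a,b}^{r,s,{\rm ev}}=\frac{1}{2}\left(q_{a,b}^{r,s}+(-1)^{r}q_{a,b}^{r,s}\right),\quad q_{a,b}^{r,s,{\rm od}}=\frac{1}{2}\left(q_{a,b}^{r,s}-(-1)^{r}q_{a,b}^{r,s}\right). \] Then \[ q_{a,b}^{r,s,{\rm od}}=(-1)^{r+1}q_{-a,b}^{r,s,{\rm od}}=(-1)^{s+1}q_{a,-b}^{r,s,{\rm od}},\quad q_{a,b}^{r,s,{\rm ev}}=(-1)^{r}q_{-a,b}^{r,s,{\rm ev}}=(-1)^{s}q_{a,-b}^{r,s,{\rm ev}}=q_{b,a}^{s,r,{\rm ev}} \] and \[ 3\sum_{r,s,a,b}q_{a,b}^{r,s,{\rm od}}Z_{a,b}^{r,s}=-\sum_{r,s,a,b}q_{a,b}^{r,s,{\rm ev}}Z_{a,b}^{r,s}-\sum_{r,s,a,b}q_{a,b}^{r,s}Z_{a+b}^{r+s}\quad\in\mathcal{P}_{k,N}^{{\rm ev}}, \] where the sums run over $r,s\geq1$ with $r+s=k$ and $(a,b)\in A(N)$. Conversely, a linear combination \[ \sum_{r,s,a,b}c_{a,b}^{r,s}Z_{a,b}^{r,s}\quad(c_{a,b}^{r,s}=(-1)^{r+1}c_{-a,b}^{r,s}=(-1)^{s+1}c_{a,-b}^{r,s})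 \] belongs to $\mathcal{P}_{k,N}^{{\rm ev}}$ if and only if $c_{a,b}^{r,s}=q_{a,b}^{r,s,{\rm od}}$ arising in this way from some $P\in\bar{W}_{w}^{\Gamma_{1}(N),+}$.
   Context: $V_w$ is the space of degree $w$ homogeneous polynomials in $X,Y$, with right ${\rm GL}(2,\mathbb{Z})$-action $P|_\gamma(X,Y)=P(aX+bY,cX+dY)$ for $\gamma=\left(\begin{smallmatrix}a&b\\c&d\end{smallmatrix}\right)$. Put $\epsilon=\left(\begin{smallmatrix}-1&0\\0&1\end{smallmatrix}\right)$, $J=\left(\begin{smallmatrix}-1&0\\0&-1\end{smallmatrix}\right)$, $S=\left(\begin{smallmatrix}0&-1\\1&0\end{smallmatrix}\right)$, $U=\left(\begin{smallmatrix}1&-1\\1&0\end{smallmatrix}\right)$. For a congruence subgroup $\Gamma$ with $\epsilon\Gamma\epsilon=\Gamma$, $\tilde V_w^\Gamma$ is the space of maps $\Gamma\backslash{\rm SL}(2,\mathbb{Z})\to V_w$ with action $P|_\gamma(C)=P(C\gamma^{-1})|_\gamma$ for $\gamma\in{\rm SL}(2,\mathbb{Z})$ and $P|_\epsilon(C)=P(\epsilon C\epsilon)|_\epsilon$; $V_w^\Gamma=\{P: P|_J=P\}$, $W_w^\Gamma=\{P\in V_w^\Gamma: P|_{1+S}=P|_{1+U+U^2}=0\}$, and $W_w^{\Gamma,\pm}$ are its $\pm1$-eigenspaces for $\epsilon$. Then $\bar W_w^{\Gamma,+}:=W_w^{\Gamma,+}$ if $w$ is even and $:=W_w^{\Gamma,-}$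 if $w$ is odd. $A(N)$ is the set of pairs $(c,d)\in(\mathbb{Z}/N\mathbb{Z})^2$ with $\gcd(c,d,N)=1$; the map $\Gamma_1(N)\left(\begin{smallmatrix}a&b\\c&d\end{smallmatrix}\right)\mapsto(c,d)$ is a bijection $\Gamma_1(N)\backslash{\rm SL}(2,\mathbb{Z})\simeq A(N)$, and $C_{a,b}$ denotes the coset corresponding to $(a,b)$. For $k\geq2$, $(k,N)\neq(2,1)$, the formal double zeta space $\mathcal{D}_{k,N}$ is the $\mathbb{Q}$-vector space with generators $Z_{a,b}^{r,s},P_{a,b}^{r,s},Z_c^k$ ($r+s=k$, $r,s\geq1$, $a,b,c\in\mathbb{Z}/N\mathbb{Z}$, $\gcd(a,b,N)=1$) and relations $P_{a,b}^{r,s}=\sum_{j=0}^{r-1}\binom{s-1+j}{j}Z_{a-b,b}^{r-j,s+j}+\sum_{j=0}^{s-1}\binom{r-1+j}{j}Z_{b-a,a}^{s-j,r+j}=Z_{a,b}^{r,s}+Z_{b,a}^{s,r}+Z_{a+b}^{r+s}$. $\mathcal{P}_{k,N}^{\rm ev}\subset\mathcal{D}_{k,N}$ is the subspace spanned by the elements $P_{a,b}^{r,s}+(-1)^rP_{-a,b}^{r,s}+(-1)^sP_{a,-b}^{r,s}+(-1)^{r+s}P_{-a,-b}^{r,s}$ ($r+s=k$, $r,s\geq1$, $\gcd(a,b,N)=1$) and $Z_a^k+(-1)^kZ_{-a}^k$ ($a\in\mathbb{Z}/N\mathbb{Z}$).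
   Formalization: The second term in the definitions of q^{ev} and q^{od} is taken as q_{-a,b}^{r,s} instead of the printed q_{a,b}^{r,s}; with the printed formula the parity relations fail, e.g. for N=3, w=0. *)

theory Defs
  imports
    "HOL-Analysis.Analysis"
    "HOL-Computational_Algebra.Polynomial"
    "HOL-Library.Poly_Mapping"
    "HOL-Number_Theory.Cong"
begin

text \<open>
  Polynomials in \<open>X\<close>, \<open>Y\<close> over the rationals are elements of \<^typ>\<open>rat poly poly\<close>: the outer
  variable is \<open>Y\<close>, the inner one is \<open>X\<close>, so the coefficient of \<open>X\<^sup>r Y\<^sup>s\<close> in \<open>p\<close> is
  \<open>coeff (coeff p s) r\<close>.
\<close>

definition varX :: "rat poly poly" where "varX = [:[:0, 1:]:]"

definition varY :: "rat poly poly" where "varY = [:0, 1:]"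

definition const2 :: "rat \<Rightarrow> rat poly poly" where "const2 c = [:[:c:]:]"

definition coeffXY :: "rat poly poly \<Rightarrow> nat \<Rightarrow> nat \<Rightarrow> rat" where
  "coeffXY p r s = coeff (coeff p s) r"

text \<open>\<open>subst_XY p A B\<close> is \<open>p(A, B)\<close>, i.e. \<open>X\<close> is replaced by \<open>A\<close> and \<open>Y\<close> by \<open>B\<close>.\<close>

definition subst_XY :: "rat poly poly \<Rightarrow> rat poly poly \<Rightarrow> rat poly poly \<Rightarrow> rat poly poly" where
  "subst_XY p A B = poly (map_poly (\<lambda>u. poly (map_poly const2 u) A) p) B"

definition V :: "nat \<Rightarrow> rat poly poly set" where
  "V w = {p. \<forall>r s. coeffXY p r s \<noteq> 0 \<longrightarrow> r + s = w}"

definition mat2 :: "int \<Rightarrow> int \<Rightarrow> int \<Rightarrow> int \<Rightarrow> int^2^2" where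
  "mat2 a b c d = vector [vector [a, b], vector [c, d]]"

definition mat_eps :: "int^2^2" where "mat_eps = mat2 (-1) 0 0 1"
definition mat_J :: "int^2^2" where "mat_J = mat2 (-1) 0 0 (-1)"
definition mat_S :: "int^2^2" where "mat_S = mat2 0 (-1) 1 0"
definition mat_U :: "int^2^2" where "mat_U = mat2 1 (-1) 1 0"

definition poly_act :: "int^2^2 \<Rightarrow> rat poly poly \<Rightarrow> rat poly poly" where
  "poly_act g p = subst_XY p (of_int (g$1$1) * varX + of_int (g$1$2) * varY)
                             (of_int (g$2$1) * varX + of_int (g$2$2) * varY)"

definition SL2Z :: "(int^2^2) set" where "SL2Z = {g. det g = 1}"

definition cosets :: "(int^2^2) set \<Rightarrow> (int^2^2) set set" where
  "cosets \<Gamma> = (\<lambda>g. (\<lambda>h. h ** g) ` \<Gamma>) ` SL2Z"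

definition Vtilde :: "(int^2^2) set \<Rightarrow> nat \<Rightarrow> ((int^2^2) set \<Rightarrow> rat poly poly) set" where
  "Vtilde \<Gamma> w = (cosets \<Gamma> \<rightarrow>\<^sub>E V w)"

definition slash ::
  "(int^2^2) set \<Rightarrow> int^2^2 \<Rightarrow> ((int^2^2) set \<Rightarrow> rat poly poly) \<Rightarrow> (int^2^2) set \<Rightarrow> rat poly poly" where
  "slash \<Gamma> g P = (\<lambda>C\<in>cosets \<Gamma>. poly_act g (P ((\<lambda>m. m ** matrix_inv g) ` C)))"

definition slash_eps ::
  "(int^2^2) set \<Rightarrow> ((int^2^2) set \<Rightarrow> rat poly poly) \<Rightarrow> (int^2^2) set \<Rightarrow> rat poly poly" where
  "slash_eps \<Gamma> P = (\<lambda>C\<in>cosets \<Gamma>. poly_act mat_eps (P ((\<lambda>m. mat_eps ** m ** mat_eps) ` C)))"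

definition VGamma :: "(int^2^2) set \<Rightarrow> nat \<Rightarrow> ((int^2^2) set \<Rightarrow> rat poly poly) set" where
  "VGamma \<Gamma> w = {P \<in> Vtilde \<Gamma> w. slash \<Gamma> mat_J P = P}"

definition WGamma :: "(int^2^2) set \<Rightarrow> nat \<Rightarrow> ((int^2^2) set \<Rightarrow> rat poly poly) set" where
  "WGamma \<Gamma> w = {P \<in> VGamma \<Gamma> w. \<forall>C\<in>cosets \<Gamma>.
      P C + slash \<Gamma> mat_S P C = 0 \<and>
      P C + slash \<Gamma> mat_U P C + slash \<Gamma> (mat_U ** mat_U) P C = 0}"

definition WGamma_plus :: "(int^2^2) set \<Rightarrow> nat \<Rightarrow> ((int^2^2) set \<Rightarrow> rat poly poly) set" where
  "WGamma_plus \<Gamma> w = {P \<in> WGamma \<Gamma> w. \<forall>C\<in>cosets \<Gamma>. slash_eps \<Gamma> P C = P C}"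

definition WGamma_minus :: "(int^2^2) set \<Rightarrow> nat \<Rightarrow> ((int^2^2) set \<Rightarrow> rat poly poly) set" where
  "WGamma_minus \<Gamma> w = {P \<in> WGamma \<Gamma> w. \<forall>C\<in>cosets \<Gamma>. slash_eps \<Gamma> P C = - P C}"

definition Wbar_plus :: "(int^2^2) set \<Rightarrow> nat \<Rightarrow> ((int^2^2) set \<Rightarrow> rat poly poly) set" where
  "Wbar_plus \<Gamma> w = (if even w then WGamma_plus \<Gamma> w else WGamma_minus \<Gamma> w)"

definition Gamma1 :: "nat \<Rightarrow> (int^2^2) set" where
  "Gamma1 N = {g \<in> SL2Z. [g$1$1 = 1] (mod int N) \<and> [g$2$1 = 0] (mod int N) \<and> [g$2$2 = 1] (mod int N)}"

text \<open>
  Residue classes modulo \<open>N\<close> are represented by the integers \<open>0, \<dots>, N - 1\<close>. The functions \<open>coset_of\<close>,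
  \<open>qcoeff\<close> and the generators \<open>Zd\<close>, \<open>Pd\<close>, \<open>Zs\<close> below take arbitrary integers as indices
  and only depend on their classes modulo \<open>N\<close>.
\<close>

definition pairsA :: "nat \<Rightarrow> (int \<times> int) set" where
  "pairsA N = {(a, b). a \<in> {0..<int N} \<and> b \<in> {0..<int N} \<and> gcd (gcd a b) (int N) = 1}"

text \<open>The coset of \<open>\<Gamma>\<^sub>1(N)\<close> whose elements have bottom row congruent to \<open>(a, b)\<close>.\<close>

definition coset_of :: "nat \<Rightarrow> int \<Rightarrow> int \<Rightarrow> (int^2^2) set" where
  "coset_of N a b = (THE C. C \<in> cosets (Gamma1 N) \<and>
      (\<exists>g\<in>C. [g$2$1 = a] (mod int N) \<and> [g$2$2 = b] (mod int N)))"

definition qpoly :: "nat \<Rightarrow> ((int^2^2) set \<Rightarrow> rat poly poly) \<Rightarrow> int \<Rightarrow> int \<Rightarrow> rat poly poly" where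
  "qpoly N P a b = subst_XY (P (coset_of N a (- a + b))) (varX - varY) varX"

definition qcoeff ::
  "nat \<Rightarrow> ((int^2^2) set \<Rightarrow> rat poly poly) \<Rightarrow> nat \<Rightarrow> nat \<Rightarrow> int \<Rightarrow> int \<Rightarrow> rat" where
  "qcoeff N P r s a b = fact (r - 1) * fact (s - 1) * coeffXY (qpoly N P a b) (r - 1) (s - 1)"

text \<open>
  The even and odd parts are taken with respect to \<open>a \<mapsto> -a\<close>. (With \<open>qcoeff N P r s a b\<close> in place
  of \<open>qcoeff N P r s (- a) b\<close> they would be \<open>q\<close> or \<open>0\<close> according to the parity of \<open>r\<close>, and
  the parity relations would fail, e.g. for \<open>N = 3\<close>, \<open>w = 0\<close>.)
\<close>

definition q_ev ::
  "nat \<Rightarrow> ((int^2^2) set \<Rightarrow> rat poly poly) \<Rightarrow> nat \<Rightarrow> nat \<Rightarrow> int \<Rightarrow> int \<Rightarrow> rat" where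
  "q_ev N P r s a b = 1/2 * (qcoeff N P r s a b + (-1)^r * qcoeff N P r s (- a) b)"

definition q_od ::
  "nat \<Rightarrow> ((int^2^2) set \<Rightarrow> rat poly poly) \<Rightarrow> nat \<Rightarrow> nat \<Rightarrow> int \<Rightarrow> int \<Rightarrow> rat" where
  "q_od N P r s a b = 1/2 * (qcoeff N P r s a b - (-1)^r * qcoeff N P r s (- a) b)"

datatype dz_gen =
    GenZ nat nat int int
  | GenP nat nat int int
  | GenZs nat int

definition rs_pairs :: "nat \<Rightarrow> (nat \<times> nat) set" where
  "rs_pairs k = {(r, s). r \<ge> 1 \<and> s \<ge> 1 \<and> r + s = k}"

definition dz_gens :: "nat \<Rightarrow> nat \<Rightarrow> dz_gen set" where
  "dz_gens k N =
     {GenZ r s a b | r s a b. (r, s) \<in> rs_pairs k \<and> (a, b) \<in> pairsA N} \<union>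
     {GenP r s a b | r s a b. (r, s) \<in> rs_pairs k \<and> (a, b) \<in> pairsA N} \<union>
     {GenZs k c | c. c \<in> {0..<int N}}"

definition dz_scale :: "rat \<Rightarrow> (dz_gen \<Rightarrow>\<^sub>0 rat) \<Rightarrow> (dz_gen \<Rightarrow>\<^sub>0 rat)" where
  "dz_scale c x = Poly_Mapping.map (\<lambda>u. c * u) x"

lemma lookup_dz_scale [simp]: "Poly_Mapping.lookup (dz_scale c x) g = c * Poly_Mapping.lookup x g"
  by (simp add: dz_scale_def Poly_Mapping.map.rep_eq when_def)

global_interpretation dz: vector_space dz_scale
  by unfold_locales (auto intro!: poly_mapping_eqI simp: lookup_add algebra_simps)

definition dz_free :: "nat \<Rightarrow> nat \<Rightarrow> (dz_gen \<Rightarrow>\<^sub>0 rat) set" where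
  "dz_free k N = {x. Poly_Mapping.keys x \<subseteq> dz_gens k N}"

definition Zd :: "nat \<Rightarrow> nat \<Rightarrow> nat \<Rightarrow> int \<Rightarrow> int \<Rightarrow> (dz_gen \<Rightarrow>\<^sub>0 rat)" where
  "Zd N r s a b = Poly_Mapping.single (GenZ r s (a mod int N) (b mod int N)) 1"

definition Pd :: "nat \<Rightarrow> nat \<Rightarrow> nat \<Rightarrow> int \<Rightarrow> int \<Rightarrow> (dz_gen \<Rightarrow>\<^sub>0 rat)" where
  "Pd N r s a b = Poly_Mapping.single (GenP r s (a mod int N) (b mod int N)) 1"

definition Zs :: "nat \<Rightarrow> nat \<Rightarrow> int \<Rightarrow> (dz_gen \<Rightarrow>\<^sub>0 rat)" where
  "Zs N k c = Poly_Mapping.single (GenZs k (c mod int N)) 1"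

definition dz_relators :: "nat \<Rightarrow> nat \<Rightarrow> (dz_gen \<Rightarrow>\<^sub>0 rat) set" where
  "dz_relators k N =
     {Pd N r s a b -
        ((\<Sum>j<r. dz_scale (of_nat ((s - 1 + j) choose j)) (Zd N (r - j) (s + j) (a - b) b)) +
         (\<Sum>j<s. dz_scale (of_nat ((r - 1 + j) choose j)) (Zd N (s - j) (r + j) (b - a) a)))
      | r s a b. (r, s) \<in> rs_pairs k \<and> (a, b) \<in> pairsA N} \<union>
     {Pd N r s a b - (Zd N r s a b + Zd N s r b a + Zs N (r + s) (a + b))
      | r s a b. (r, s) \<in> rs_pairs k \<and> (a, b) \<in> pairsA N}"

definition dz_rel :: "nat \<Rightarrow> nat \<Rightarrow> ((dz_gen \<Rightarrow>\<^sub>0 rat) \<times> (dz_gen \<Rightarrow>\<^sub>0 rat)) set" where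
  "dz_rel k N = {(x, y). x \<in> dz_free k N \<and> y \<in> dz_free k N \<and> x - y \<in> dz.span (dz_relators k N)}"

text \<open>
  The space \<open>\<D>\<^sub>k\<^sub>,\<^sub>N\<close> is the quotient of the free rational vector space on the generators by the span of
  the relators; \<open>dz_class k N\<close> is the quotient map, defined on \<open>dz_free k N\<close>. As it is linear,
  linear combinations are formed before applying it.
\<close>

definition dz_space :: "nat \<Rightarrow> nat \<Rightarrow> (dz_gen \<Rightarrow>\<^sub>0 rat) set set" where
  "dz_space k N = dz_free k N // dz_rel k N"

definition dz_class :: "nat \<Rightarrow> nat \<Rightarrow> (dz_gen \<Rightarrow>\<^sub>0 rat) \<Rightarrow> (dz_gen \<Rightarrow>\<^sub>0 rat) set" where
  "dz_class k N x = dz_rel k N `` {x}"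

definition P_ev :: "nat \<Rightarrow> nat \<Rightarrow> (dz_gen \<Rightarrow>\<^sub>0 rat) set set" where
  "P_ev k N = dz_class k N ` dz.span (
     {Pd N r s a b + dz_scale ((-1)^r) (Pd N r s (- a) b)
        + dz_scale ((-1)^s) (Pd N r s a (- b)) + dz_scale ((-1)^(r + s)) (Pd N r s (- a) (- b))
      | r s a b. (r, s) \<in> rs_pairs k \<and> (a, b) \<in> pairsA N} \<union>
     {Zs N k a + dz_scale ((-1)^k) (Zs N k (- a)) | a. a \<in> {0..<int N}})"

lemma V_add: "p \<in> V w \<Longrightarrow> q \<in> V w \<Longrightarrow> p + q \<in> V w"
  unfolding V_def coeffXY_def by (auto; metis add.right_neutral)

lemma V_sum: "(\<And>i. i \<in> I \<Longrightarrow> f i \<in> V w) \<Longrightarrow> sum f I \<in> V w"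
  by (induction I rule: infinite_finite_induct) (auto simp: V_add, auto simp: V_def coeffXY_def)

lemma V_mult:
  assumes "p \<in> V m" "q \<in> V n"
  shows "p * q \<in> V (m + n)"
  unfolding V_def mem_Collect_eq
proof (intro allI impI)
  fix r s assume "coeffXY (p * q) r s \<noteq> 0"
  then have "(\<Sum>i\<le>s. \<Sum>j\<le>r. coeffXY p j i * coeffXY q (r - j) (s - i)) \<noteq> 0"
    by (simp add: coeffXY_def coeff_mult coeff_sum)
  then obtain i j where "i \<le> s" "j \<le> r" "coeffXY p j i * coeffXY q (r - j) (s - i) \<noteq> 0"
    by (metis (no_types, lifting) atMost_iff sum.neutral)
  with assms have "j + i = m" "(r - j) + (s - i) = n"
    by (auto simp: V_def)
  with \<open>i \<le> s\<close> \<open>j \<le> r\<close> show "r + s = m + n" by simp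
qed

lemma V_const2: "const2 c \<in> V 0"
  by (auto simp: V_def coeffXY_def const2_def coeff_pCons split: nat.splits)

lemma V_varX: "varX \<in> V 1"
  by (auto simp: V_def coeffXY_def varX_def coeff_pCons split: nat.splits)

lemma V_varX_minus_varY: "varX - varY \<in> V 1"
  by (auto simp: V_def coeffXY_def varX_def varY_def coeff_pCons split: nat.splits)

lemma V_power: "p \<in> V 1 \<Longrightarrow> p ^ n \<in> V n"
proof (induction n)
  case 0
  show ?case using V_const2[of 1] by (simp add: const2_def one_pCons)
next
  case (Suc n)
  then show ?case using V_mult[of p 1 "p ^ n" n] by simp
qed

lemma const2_0 [simp]: "const2 0 = 0"
  by (simp add: const2_def)

lemma subst_XY_altdef:
  "subst_XY p A B = (\<Sum>s\<le>degree p. \<Sum>r\<le>degree (coeff p s). const2 (coeffXY p r s) * A ^ r * B ^ s)"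
proof -
  have inner: "poly (map_poly const2 u) A = (\<Sum>r\<le>degree u. const2 (coeff u r) * A ^ r)" for u
    unfolding poly_altdef
    by (rule sum.mono_neutral_cong_left)
       (auto simp: coeff_map_poly map_poly_degree_leq intro: coeff_eq_0 le_degree)
  have "subst_XY p A B = (\<Sum>s\<le>degree p. poly (map_poly const2 (coeff p s)) A * B ^ s)"
    unfolding subst_XY_def poly_altdef[of "map_poly _ p"]
    by (rule sum.mono_neutral_cong_left)
       (auto simp: coeff_map_poly map_poly_degree_leq intro: coeff_eq_0 le_degree)
  then show ?thesis
    by (simp add: inner sum_distrib_right coeffXY_def)
qed

lemma V_subst_XY:
  assumes "p \<in> V w" "A \<in> V 1" "B \<in> V 1"
  shows "subst_XY p A B \<in> V w"
  unfolding subst_XY_altdef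
proof (intro V_sum)
  fix r s
  show "const2 (coeffXY p r s) * A ^ r * B ^ s \<in> V w"
  proof (cases "coeffXY p r s = 0")
    case True
    then show ?thesis by (simp add: V_def coeffXY_def)
  next
    case False
    then have "r + s = w" using assms(1) by (auto simp: V_def)
    then show ?thesis
      using V_mult[OF V_mult[OF V_const2 V_power[OF assms(2)]] V_power[OF assms(3)],
          of "coeffXY p r s" r s] by simp
  qed
qed

lemma coeffXY_monomial:
  "coeffXY (const2 c * varX ^ i * varY ^ j) r s = (if r = i \<and> s = j then c else 0)"
proof -
  have "const2 c * varX ^ i * varY ^ j = monom (monom c i) j"
    by (simp add: const2_def varX_def varY_def monom_altdef poly_const_pow)
  then show ?thesis by (simp add: coeffXY_def)
qed

lemma coeffXY_sum: "coeffXY (sum f I) r s = (\<Sum>i\<in>I. coeffXY (f i) r s)"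
  by (simp add: coeffXY_def coeff_sum)

text \<open>The expansion by which the coefficients \<open>q\<close> are characterised.\<close>

lemma qpoly_expansion:
  assumes "P (coset_of N a (- a + b)) \<in> V w"
  shows "qpoly N P a b =
    (\<Sum>r\<le>w. const2 (1 / (fact r * fact (w - r)) * qcoeff N P (r + 1) (w - r + 1) a b)
             * varX ^ r * varY ^ (w - r))" (is "_ = ?R")
proof -
  have V: "qpoly N P a b \<in> V w"
    unfolding qpoly_def by (intro V_subst_XY assms V_varX V_varX_minus_varY)
  have "coeffXY (qpoly N P a b) i j = coeffXY ?R i j" for i j
  proof -
    have "coeffXY ?R i j = (\<Sum>r\<le>w. if i = r \<and> j = w - r then coeffXY (qpoly N P a b) r (w - r) else 0)"
      by (simp add: coeffXY_sum coeffXY_monomial qcoeff_def)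
    also have "\<dots> = (\<Sum>r\<le>w. if r = i then (if j = w - i then coeffXY (qpoly N P a b) i (w - i) else 0) else 0)"
      by (intro sum.cong) auto
    also have "\<dots> = (if i \<le> w \<and> j = w - i then coeffXY (qpoly N P a b) i j else 0)"
      by (auto simp: sum.delta)
    also have "\<dots> = coeffXY (qpoly N P a b) i j"
      using V by (force simp: V_def)
    finally show ?thesis ..
  qed
  then show ?thesis
    by (intro poly_eqI) (simp add: coeffXY_def)
qed

lemma equiv_dz_rel: "equiv (dz_free k N) (dz_rel k N)"
proof (rule equivI)
  show "dz_rel k N \<subseteq> dz_free k N \<times> dz_free k N"
    by (auto simp: dz_rel_def)
  show "refl_on (dz_free k N) (dz_rel k N)"
    by (auto simp: refl_on_def dz_rel_def dz.span_zero)
  show "sym (dz_rel k N)"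
    by (auto simp: sym_def dz_rel_def) (metis dz.span_neg minus_diff_eq)
  show "trans (dz_rel k N)"
    unfolding trans_def dz_rel_def
    by auto (metis (no_types, lifting) dz.span_add diff_add_cancel add_diff_eq)
qed

end

theory Submission
  imports Defs
begin

text \<open>
  A family of coefficients \<open>h\<^sup>r\<^sup>,\<^sup>s\<^sub>a\<^sub>,\<^sub>b\<close> is encoded by the polynomial functions
  \<open>f\<^sub>v(x, y) = \<Sum> h\<^sup>r\<^sup>,\<^sup>s\<^sub>v x\<^sup>r\<^sup>-\<^sup>1 y\<^sup>s\<^sup>-\<^sup>1 / ((r-1)! (s-1)!)\<close>, on which integral matrices act by
  \<open>(f|M)\<^sub>v(z) = f\<^bsub>Mv\<^esub>(Mz)\<close>. Let \<open>T = (1 1; 0 1)\<close>, let \<open>\<sigma>\<close> be the swap of coordinates, and put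
  \<open>\<delta> = diag(-1, 1)\<close> and \<open>\<alpha> = T\<delta>\<close>. Rewriting \<open>P\<close>-generators with coefficients \<open>f\<close> by the stuffle
  relation gives the \<open>Z\<close>-coefficients \<open>f|(1 + \<sigma>)\<close>, and by the shuffle relation \<open>f|(1 + \<sigma>)T\<close>.

  The family \<open>Q\<close> attached to a period polynomial satisfies \<open>Q|T = -Q|\<delta>\<close> and
  \<open>Q|\<sigma>T = Q|\<sigma> - Q\<close>, and its even part \<open>Q|(1 - \<delta>)/2\<close> is
  symmetric. So stuffle minus shuffle applied to \<open>Q\<close> yields \<open>2Q + Q|\<delta>\<close>, which is three times
  the odd part plus the even part.

  Conversely, a relation placing an odd family \<open>C\<close> in the even subspace amounts to
  \<open>C = G|(T - 1) + E\<close> with \<open>G\<close> symmetric and \<open>E\<close> even and symmetric. Then \<open>Q = G|(\<alpha> - 1)\<close> comes from a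
  period polynomial and has odd part \<open>C\<close>.
\<close>

section \<open>Binary forms as functions\<close>

definition ev :: "rat poly poly \<Rightarrow> rat \<Rightarrow> rat \<Rightarrow> rat" where
  "ev p x y = poly (poly p [:y:]) x"

lemma ev_simps [simp]:
  "ev 0 x y = 0" "ev (p + q) x y = ev p x y + ev q x y" "ev (- p) x y = - ev p x y"
  "ev (p - q) x y = ev p x y - ev q x y" "ev (p * q) x y = ev p x y * ev q x y"
  "ev (p ^ n) x y = ev p x y ^ n" "ev (const2 c) x y = c" "ev varX x y = x" "ev varY x y = y"
  "ev (of_int m) x y = of_int m"
  by (simp_all add: ev_def const2_def varX_def varY_def of_int_poly)

lemma ev_sum [simp]: "ev (sum f I) x y = (\<Sum>i\<in>I. ev (f i) x y)"
  by (simp add: ev_def poly_sum)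

lemma ev_altdef:
  "ev p x y = (\<Sum>s\<le>degree p. \<Sum>r\<le>degree (coeff p s). coeffXY p r s * x ^ r * y ^ s)"
  by (simp add: ev_def poly_altdef[of p] poly_altdef[of "coeff p _"] poly_sum coeffXY_def sum_distrib_right)

lemma ev_subst_XY: "ev (subst_XY p A B) x y = ev p (ev A x y) (ev B x y)"
  by (simp add: subst_XY_altdef ev_altdef[of p])

text \<open>A nonzero polynomial in \<open>Y\<close> over the polynomials in \<open>X\<close> has
  finitely many roots, while the constants \<open>[:y:]\<close> would be infinitely many. Hence
  identities between forms may be checked at rational points.\<close>

lemma ev_eqI:
  assumes "\<And>x y. ev p x y = ev q x y"
  shows "p = q"
proof (rule ccontr)
  assume "p \<noteq> q"
  then have "finite {z. poly (p - q) z = 0}" by (intro poly_roots_finite) simp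
  moreover have "range (\<lambda>y. [:y:]) \<subseteq> {z. poly (p - q) z = 0}"
  proof -
    have "poly (poly (p - q) [:y:]) x = 0" for x y
      using assms[of x y] by (simp add: ev_def)
    then show ?thesis using poly_all_0_iff_0 by blast
  qed
  moreover have "infinite (range (\<lambda>y::rat. [:y:]))"
    by (simp add: range_inj_infinite infinite_UNIV_char_0 inj_def finite_image_iff)
  ultimately show False by (meson finite_subset)
qed

lemma ev_eq_iff: "p = q \<longleftrightarrow> (\<forall>x y. ev p x y = ev q x y)"
  by (auto intro: ev_eqI)

lemma finite_rs_pairs [simp]: "finite (rs_pairs k)"
  by (rule finite_subset[of _ "{..k} \<times> {..k}"]) (auto simp: rs_pairs_def)

lemma rs_pairs_swap: "(r, s) \<in> rs_pairs k \<longleftrightarrow> (s, r) \<in> rs_pairs k"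
  by (auto simp: rs_pairs_def)

section \<open>Divided-power monomials and generating functions of coefficients\<close>

definition divmon :: "nat \<Rightarrow> nat \<Rightarrow> rat \<Rightarrow> rat \<Rightarrow> rat" where
  "divmon r s x y = x ^ (r - 1) * y ^ (s - 1) / (fact (r - 1) * fact (s - 1))"

text \<open>With this normalisation the shuffle relation becomes the substitution
  \<open>(x, y) \<mapsto> (x + y, y)\<close>.\<close>

definition hpoly :: "nat \<Rightarrow> (nat \<Rightarrow> nat \<Rightarrow> rat) \<Rightarrow> rat \<Rightarrow> rat \<Rightarrow> rat" where
  "hpoly k h x y = (\<Sum>(r, s)\<in>rs_pairs k. h r s * divmon r s x y)"

lemma divmon_swap: "divmon s r y x = divmon r s x y"
  by (simp add: divmon_def mult.commute)

lemma divmon_uminus: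
  assumes "r \<ge> 1"
  shows "divmon r s (- x) y = - ((- 1) ^ r * divmon r s x y)"
proof -
  obtain m where "r = Suc m" using assms by (cases r) auto
  then show ?thesis by (simp add: divmon_def power_minus[of x])
qed

text \<open>Binomial theorem for \<open>(x + y) ^ (r - 1)\<close>: in the divided-power
  normalisation the product of \<open>y ^ j / fact j\<close> and
  \<open>y ^ (s - 1) / fact (s - 1)\<close> carries the factor
  \<open>(s - 1 + j) choose j\<close>.\<close>

lemma divmon_shuffle:
  assumes "r \<ge> 1" "s \<ge> 1"
  shows "(\<Sum>j<r. of_nat ((s - 1 + j) choose j) * divmon (r - j) (s + j) x y) = divmon r s (x + y) y"
proof -
  obtain m n where rs: "r = Suc m" "s = Suc n" using assms by (cases r; cases s) auto
  have "divmon r s (x + y) y = (\<Sum>j\<le>m. of_nat (m choose j) * y ^ j * x ^ (m - j)) * y ^ n / (fact m * fact n)"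
    by (simp add: divmon_def rs add.commute[of x y] binomial_ring)
  also have "\<dots> = (\<Sum>j\<le>m. of_nat (m choose j) * y ^ j * x ^ (m - j) * y ^ n / (fact m * fact n))"
    by (simp add: sum_distrib_right sum_divide_distrib)
  also have "\<dots> = (\<Sum>j\<le>m. of_nat ((n + j) choose j) * divmon (r - j) (s + j) x y)"
  proof (rule sum.cong)
    fix j assume "j \<in> {..m}"
    then have *: "j \<le> m" "j \<le> n + j" by auto
    show "of_nat (m choose j) * y ^ j * x ^ (m - j) * y ^ n / (fact m * fact n) =
        of_nat ((n + j) choose j) * divmon (r - j) (s + j) x y"
      using * by (simp add: divmon_def rs binomial_fact power_add Suc_diff_le field_simps)
  qed simp
  finally show ?thesis by (simp add: rs lessThan_Suc_atMost)
qed

lemma hpoly_add: "hpoly k (\<lambda>r s. f r s + g r s) x y = hpoly k f x y + hpoly k g x y"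
  by (simp add: hpoly_def case_prod_unfold sum.distrib algebra_simps)

lemma hpoly_diff: "hpoly k (\<lambda>r s. f r s - g r s) x y = hpoly k f x y - hpoly k g x y"
  by (simp add: hpoly_def case_prod_unfold sum_subtractf algebra_simps)

lemma hpoly_scale: "hpoly k (\<lambda>r s. c * f r s) x y = c * hpoly k f x y"
  by (simp add: hpoly_def case_prod_unfold sum_distrib_left algebra_simps)

lemma hpoly_zero [simp]: "hpoly k (\<lambda>r s. 0) x y = 0"
  by (simp add: hpoly_def)

lemma hpoly_cong:
  "(\<And>r s. (r, s) \<in> rs_pairs k \<Longrightarrow> f r s = g r s) \<Longrightarrow> hpoly k f x y = hpoly k g x y"
  unfolding hpoly_def by (intro sum.cong) auto

lemma hpoly_swap: "hpoly k (\<lambda>r s. h s r) x y = hpoly k h y x"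
  unfolding hpoly_def
  by (rule sum.reindex_bij_witness[of _ prod.swap prod.swap])
     (auto simp: rs_pairs_swap intro: divmon_swap)

text \<open>The exponent of \<open>x\<close> is \<open>r - 1\<close>, so the parity sign
  \<open>(-1) ^ r\<close> differs by -1 from the sign produced by negating \<open>x\<close>. This is
  why even families of coefficients have generating functions that are negated by a sign
  change.\<close>

lemma hpoly_uminus_left: "hpoly k (\<lambda>r s. (-1) ^ r * h r s) x y = - hpoly k h (- x) y"
  unfolding hpoly_def sum_negf[symmetric]
  by (intro sum.cong) (auto simp: rs_pairs_def divmon_uminus)

lemma hpoly_uminus_right: "hpoly k (\<lambda>r s. (-1) ^ s * h r s) x y = - hpoly k h x (- y)"
  using hpoly_uminus_left[of k "\<lambda>r s. h s r" y x] hpoly_swap[of k h "-y" x]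
    hpoly_swap[of k "\<lambda>r s. (-1) ^ s * h r s" y x] hpoly_swap[of k h x "-y"] by simp

lemma hpoly_delta:
  assumes "(r, s) \<in> rs_pairs k"
  shows "hpoly k (\<lambda>r' s'. if r' = r \<and> s' = s then c else 0) x y = c * divmon r s x y"
proof -
  have "hpoly k (\<lambda>r' s'. if r' = r \<and> s' = s then c else 0) x y =
      (\<Sum>p\<in>rs_pairs k. if p = (r, s) then c * divmon r s x y else 0)"
    unfolding hpoly_def by (intro sum.cong) (auto split: if_splits)
  then show ?thesis using assms by (simp add: sum.delta)
qed

text \<open>The polynomial behind the function \<open>hpoly k h\<close>; it allows the coefficients
  to be recovered from the values.\<close>

definition hform :: "nat \<Rightarrow> (nat \<Rightarrow> nat \<Rightarrow> rat) \<Rightarrow> rat poly poly" where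
  "hform k h = (\<Sum>(r, s)\<in>rs_pairs k.
     const2 (h r s / (fact (r - 1) * fact (s - 1))) * varX ^ (r - 1) * varY ^ (s - 1))"

lemma ev_hform: "ev (hform k h) x y = hpoly k h x y"
  by (simp add: hform_def hpoly_def divmon_def case_prod_unfold mult.assoc)

lemma coeffXY_hform:
  assumes "(r, s) \<in> rs_pairs k"
  shows "coeffXY (hform k h) (r - 1) (s - 1) = h r s / (fact (r - 1) * fact (s - 1))"
proof -
  have "coeffXY (hform k h) (r - 1) (s - 1) = (\<Sum>p\<in>rs_pairs k. if p = (r, s) then h r s / (fact (r - 1) * fact (s - 1)) else 0)"
    unfolding hform_def coeffXY_sum case_prod_unfold coeffXY_monomial
    using assms by (intro sum.cong) (auto simp: rs_pairs_def)
  then show ?thesis using assms by (simp add: sum.delta)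
qed

lemma V_hform: "hform (w + 2) h \<in> V w"
  unfolding V_def hform_def coeffXY_sum case_prod_unfold coeffXY_monomial mem_Collect_eq
proof (intro allI impI)
  fix r s
  assume "(\<Sum>p\<in>rs_pairs (w + 2). if r = fst p - 1 \<and> s = snd p - 1
      then h (fst p) (snd p) / (fact (fst p - 1) * fact (snd p - 1)) else 0) \<noteq> 0"
  then obtain p where "p \<in> rs_pairs (w + 2)" "r = fst p - 1 \<and> s = snd p - 1"
    by (elim sum.not_neutral_contains_not_neutral) (auto split: if_splits)
  then show "r + s = w" by (auto simp: rs_pairs_def)
qed

lemma hpoly_eqD:
  assumes "\<And>x y. hpoly k f x y = hpoly k g x y" "(r, s) \<in> rs_pairs k"
  shows "f r s = g r s"
proof -
  have "hform k f = hform k g" by (rule ev_eqI) (simp add: ev_hform assms)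
  then show ?thesis
    using coeffXY_hform[OF assms(2), of f] coeffXY_hform[OF assms(2), of g] by simp
qed

lemma coeffXY_eqI: "(\<And>i j. coeffXY p i j = coeffXY q i j) \<Longrightarrow> p = q"
  by (intro poly_eqI) (simp add: coeffXY_def)

lemma V_expand:
  assumes "p \<in> V w"
  shows "p = hform (w + 2) (\<lambda>r s. fact (r - 1) * fact (s - 1) * coeffXY p (r - 1) (s - 1))"
    (is "_ = ?h")
proof -
  have "coeffXY p i j = coeffXY ?h i j" for i j
  proof (cases "i + j = w")
    case True
    then have "(Suc i, Suc j) \<in> rs_pairs (w + 2)" by (simp add: rs_pairs_def)
    from coeffXY_hform[OF this] show ?thesis by simp
  next
    case False
    then show ?thesis using assms V_hform unfolding V_def by (metis (mono_tags, lifting) mem_Collect_eq)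
  qed
  then show ?thesis by (rule coeffXY_eqI)
qed

lemma ev_V:
  assumes "p \<in> V w"
  shows "ev p x y = hpoly (w + 2) (\<lambda>r s. fact (r - 1) * fact (s - 1) * coeffXY p (r - 1) (s - 1)) x y"
  by (subst V_expand[OF assms]) (rule ev_hform)

section \<open>Functions given by forms of fixed degree\<close>

definition homog :: "nat \<Rightarrow> (rat \<Rightarrow> rat \<Rightarrow> rat) \<Rightarrow> bool" where
  "homog w \<phi> \<longleftrightarrow> (\<exists>p\<in>V w. \<forall>x y. \<phi> x y = ev p x y)"

lemma homog_hpoly: "homog w (hpoly (w + 2) h)"
  unfolding homog_def by (intro bexI[OF _ V_hform] allI) (rule ev_hform[symmetric])

lemma homog_add: "homog w f \<Longrightarrow> homog w g \<Longrightarrow> homog w (\<lambda>x y. f x y + g x y)"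
  unfolding homog_def by (metis V_add ev_simps(2))

lemma homog_scale:
  assumes "homog w f"
  shows "homog w (\<lambda>x y. c * f x y)"
proof -
  obtain p where "p \<in> V w" "\<And>x y. f x y = ev p x y" using assms by (auto simp: homog_def)
  moreover have "const2 c * p \<in> V w" using V_mult[OF V_const2 \<open>p \<in> V w\<close>] by simp
  ultimately show ?thesis unfolding homog_def by (intro bexI[of _ "const2 c * p"]) simp_all
qed

lemma homog_diff: "homog w f \<Longrightarrow> homog w g \<Longrightarrow> homog w (\<lambda>x y. f x y - g x y)"
  using homog_add[of w f "\<lambda>x y. -1 * g x y"] homog_scale[of w g "-1"] by simp

lemma V_varY: "varY \<in> V 1"
  by (auto simp: V_def coeffXY_def varY_def coeff_pCons split: nat.splits)

lemma V_linear: "const2 c * varX + const2 d * varY \<in> V 1"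
  using V_add V_mult[OF V_const2 V_varX] V_mult[OF V_const2 V_varY] by fastforce

lemma homog_linear:
  assumes "homog w f"
  shows "homog w (\<lambda>x y. f (a * x + b * y) (c * x + d * y))"
proof -
  obtain p where "p \<in> V w" "\<And>x y. f x y = ev p x y" using assms by (auto simp: homog_def)
  then show ?thesis unfolding homog_def
    using V_subst_XY[OF \<open>p \<in> V w\<close> V_linear[of a b] V_linear[of c d]]
    by (intro bexI[of _ "subst_XY p (const2 a * varX + const2 b * varY) (const2 c * varX + const2 d * varY)"])
       (simp_all add: ev_subst_XY)
qed

lemma homog_uminus:
  assumes "homog w f"
  shows "f (- x) (- y) = (- 1) ^ w * f x y"
proof -
  obtain p where p: "p \<in> V w" "\<And>x y. f x y = ev p x y" using assms by (auto simp: homog_def)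
  let ?h = "\<lambda>r s. fact (r - 1) * fact (s - 1) * coeffXY p (r - 1) (s - 1)"
  have "f (- x) (- y) = hpoly (w + 2) (\<lambda>r s. (-1) ^ r * ((-1) ^ s * ?h r s)) x y"
    by (simp only: hpoly_uminus_left hpoly_uminus_right p(2) ev_V[OF p(1)] minus_minus)
  also have "\<dots> = hpoly (w + 2) (\<lambda>r s. (-1) ^ w * ?h r s) x y"
    by (rule hpoly_cong) (auto simp: rs_pairs_def simp flip: power_add mult.assoc)
  finally show ?thesis by (simp only: hpoly_scale p(2) ev_V[OF p(1)])
qed

section \<open>The formal double zeta space\<close>

text \<open>The condition defining A(N), for arbitrary integers instead of the representatives
  collected in \<open>pairsA\<close>, so that indices can be negated and sheared without
  reduction.\<close>

definition cop :: "nat \<Rightarrow> int \<Rightarrow> int \<Rightarrow> bool" where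
  "cop N a b \<longleftrightarrow> gcd (gcd a b) (int N) = 1"

lemma cop_mod_left [simp]: "cop N (a mod int N) b = cop N a b"
proof -
  have "gcd (a mod int N) (int N) = gcd a (int N)"
    by (metis gcd.commute gcd_red_int)
  then show ?thesis by (metis cop_def gcd.assoc gcd.commute)
qed

lemma cop_commute: "cop N a b = cop N b a"
  by (simp add: cop_def gcd.commute[of a b])

lemma cop_mod_right [simp]: "cop N a (b mod int N) = cop N a b"
  by (metis cop_commute cop_mod_left)

lemma cop_uminus [simp]: "cop N (- a) b = cop N a b" "cop N a (- b) = cop N a b"
  by (simp_all add: cop_def)

lemma cop_cong: "[a = a'] (mod int N) \<Longrightarrow> [b = b'] (mod int N) \<Longrightarrow> cop N a b = cop N a' b'"
  by (metis cong_def cop_mod_left cop_mod_right)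

lemma cop_add [simp]: "cop N (a + b) b = cop N a b" "cop N a (a + b) = cop N a b"
    "cop N a (b - a) = cop N a b" "cop N (a - b) b = cop N a b"
  by (simp_all add: cop_def gcd_diff1 gcd.commute[of a "b - a"] gcd.commute[of a b])

lemma pairsA_iff: "(a, b) \<in> pairsA N \<longleftrightarrow> a \<in> {0..<int N} \<and> b \<in> {0..<int N} \<and> cop N a b"
  by (simp add: pairsA_def cop_def)

lemma finite_pairsA [simp]: "finite (pairsA N)"
  by (rule finite_subset[of _ "{0..<int N} \<times> {0..<int N}"]) (auto simp: pairsA_iff)

lemma pairsA_mod: "(a, b) \<in> pairsA N \<Longrightarrow> a mod int N = a \<and> b mod int N = b \<and> cop N a b"
  by (auto simp: pairsA_iff)

lemma mod_pairsA: "N \<ge> 1 \<Longrightarrow> (a mod int N, b mod int N) \<in> pairsA N \<longleftrightarrow> cop N a b"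
  by (auto simp: pairsA_iff)

section \<open>Elements of the free space as families of forms\<close>

lemma lookup_sum: "Poly_Mapping.lookup (sum f I) g = (\<Sum>i\<in>I. Poly_Mapping.lookup (f i) g)"
  by (induction I rule: infinite_finite_induct) (auto simp: lookup_add)

abbreviation lk :: "(dz_gen \<Rightarrow>\<^sub>0 rat) \<Rightarrow> dz_gen \<Rightarrow> rat" where "lk \<equiv> Poly_Mapping.lookup"

text \<open>The polynomial functions attached to the coefficients at the \<open>GenZ\<close>
  generators; \<open>ppart\<close> does the same for \<open>GenP\<close>. The indices are arbitrary
  integers, so that matrices can act on them.\<close>

definition zpart :: "nat \<Rightarrow> nat \<Rightarrow> (dz_gen \<Rightarrow>\<^sub>0 rat) \<Rightarrow> int \<Rightarrow> int \<Rightarrow> rat \<Rightarrow> rat \<Rightarrow> rat" where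
  "zpart k N x a b = hpoly k (\<lambda>r s. lk x (GenZ r s (a mod int N) (b mod int N)))"

definition ppart :: "nat \<Rightarrow> nat \<Rightarrow> (dz_gen \<Rightarrow>\<^sub>0 rat) \<Rightarrow> int \<Rightarrow> int \<Rightarrow> rat \<Rightarrow> rat \<Rightarrow> rat" where
  "ppart k N x a b = hpoly k (\<lambda>r s. lk x (GenP r s (a mod int N) (b mod int N)))"

lemma zpart_linear:
  "zpart k N 0 a b X Y = 0"
  "zpart k N (x + y) a b X Y = zpart k N x a b X Y + zpart k N y a b X Y"
  "zpart k N (x - y) a b X Y = zpart k N x a b X Y - zpart k N y a b X Y"
  "zpart k N (dz_scale c x) a b X Y = c * zpart k N x a b X Y"
  by (simp_all add: zpart_def lookup_add lookup_minus hpoly_add hpoly_diff hpoly_scale)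

lemma ppart_linear:
  "ppart k N 0 a b X Y = 0"
  "ppart k N (x + y) a b X Y = ppart k N x a b X Y + ppart k N y a b X Y"
  "ppart k N (x - y) a b X Y = ppart k N x a b X Y - ppart k N y a b X Y"
  "ppart k N (dz_scale c x) a b X Y = c * ppart k N x a b X Y"
  by (simp_all add: ppart_def lookup_add lookup_minus hpoly_add hpoly_diff hpoly_scale)

lemma zpart_sum: "zpart k N (sum f I) a b X Y = (\<Sum>i\<in>I. zpart k N (f i) a b X Y)"
  by (induction I rule: infinite_finite_induct) (auto simp: zpart_linear)

lemma ppart_sum: "ppart k N (sum f I) a b X Y = (\<Sum>i\<in>I. ppart k N (f i) a b X Y)"
  by (induction I rule: infinite_finite_induct) (auto simp: ppart_linear)

definition same :: "nat \<Rightarrow> int \<Rightarrow> int \<Rightarrow> int \<Rightarrow> int \<Rightarrow> bool" where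
  "same N a b c d \<longleftrightarrow> [a = c] (mod int N) \<and> [b = d] (mod int N)"

lemma zpart_Zd: "(r, s) \<in> rs_pairs k \<Longrightarrow>
    zpart k N (Zd N r s a b) c d X Y = (if same N a b c d then divmon r s X Y else 0)"
  unfolding zpart_def
  by (rule trans[OF hpoly_cong hpoly_delta[of r s k "if same N a b c d then 1 else 0", THEN trans]])
     (auto simp: Zd_def lookup_single when_def same_def cong_def)

lemma ppart_Pd: "(r, s) \<in> rs_pairs k \<Longrightarrow>
    ppart k N (Pd N r s a b) c d X Y = (if same N a b c d then divmon r s X Y else 0)"
  unfolding ppart_def
  by (rule trans[OF hpoly_cong hpoly_delta[of r s k "if same N a b c d then 1 else 0", THEN trans]])
     (auto simp: Pd_def lookup_single when_def same_def cong_def)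

lemma other_parts [simp]:
  "zpart k N (Pd N r s a b) c d X Y = 0" "zpart k N (Zs N r a) c d X Y = 0"
  "ppart k N (Zd N r s a b) c d X Y = 0" "ppart k N (Zs N r a) c d X Y = 0"
  "lk (Zd N r s a b) (GenZs j t) = 0" "lk (Pd N r s a b) (GenZs j t) = 0"
  by (simp_all add: zpart_def ppart_def Zd_def Pd_def Zs_def lookup_single)

text \<open>Each coefficient at a double generator is recovered from \<open>zpart\<close> or
  \<open>ppart\<close> by \<open>hpoly_eqD\<close>, and outside \<open>dz_gens k N\<close> both
  elements vanish. Identities in the free space thereby become identities of functions.\<close>

lemma dz_eqI:
  assumes "x \<in> dz_free k N" "y \<in> dz_free k N"
    and "\<And>a b X Y. zpart k N x a b X Y = zpart k N y a b X Y"
    and "\<And>a b X Y. ppart k N x a b X Y = ppart k N y a b X Y"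
    and "\<And>c. lk x (GenZs k c) = lk y (GenZs k c)"
  shows "x = y"
proof (rule poly_mapping_eqI)
  fix g
  show "lk x g = lk y g"
  proof (cases "g \<in> dz_gens k N")
    case False
    then have "g \<notin> Poly_Mapping.keys x" "g \<notin> Poly_Mapping.keys y" using assms(1,2) by (auto simp: dz_free_def)
    then show ?thesis by (simp add: in_keys_iff)
  next
    case True
    then consider r s a b where "g = GenZ r s a b" "(r, s) \<in> rs_pairs k" "(a, b) \<in> pairsA N"
      | r s a b where "g = GenP r s a b" "(r, s) \<in> rs_pairs k" "(a, b) \<in> pairsA N"
      | c where "g = GenZs k c"
      by (auto simp: dz_gens_def)
    then show ?thesis
    proof cases
      case (1 r s a b)
      have "lk x (GenZ r s (a mod int N) (b mod int N)) = lk y (GenZ r s (a mod int N) (b mod int N))"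
        by (rule hpoly_eqD[OF _ 1(2)]) (use assms(3) in \<open>simp add: zpart_def\<close>)
      with 1 show ?thesis by (simp add: pairsA_mod)
    next
      case (2 r s a b)
      have "lk x (GenP r s (a mod int N) (b mod int N)) = lk y (GenP r s (a mod int N) (b mod int N))"
        by (rule hpoly_eqD[OF _ 2(2)]) (use assms(4) in \<open>simp add: ppart_def\<close>)
      with 2 show ?thesis by (simp add: pairsA_mod)
    next
      case 3
      then show ?thesis by (simp add: assms(5))
    qed
  qed
qed

lemma subspace_dz_free: "dz.subspace (dz_free k N)"
proof (rule dz.subspaceI)
  show "0 \<in> dz_free k N" by (simp add: dz_free_def)
  show "x + y \<in> dz_free k N" if "x \<in> dz_free k N" "y \<in> dz_free k N" for x y
    using that keys_add[of x y] by (auto simp: dz_free_def)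
  show "dz_scale c x \<in> dz_free k N" if "x \<in> dz_free k N" for c x
    using that by (auto simp: dz_free_def in_keys_iff)
qed

lemma Zd_free: "N \<ge> 1 \<Longrightarrow> (r, s) \<in> rs_pairs k \<Longrightarrow> cop N a b \<Longrightarrow> Zd N r s a b \<in> dz_free k N"
  by (auto simp: dz_free_def Zd_def dz_gens_def mod_pairsA)

lemma Pd_free: "N \<ge> 1 \<Longrightarrow> (r, s) \<in> rs_pairs k \<Longrightarrow> cop N a b \<Longrightarrow> Pd N r s a b \<in> dz_free k N"
  by (auto simp: dz_free_def Pd_def dz_gens_def mod_pairsA)

lemma Zs_free: "N \<ge> 1 \<Longrightarrow> Zs N k c \<in> dz_free k N"
  by (auto simp: dz_free_def Zs_def dz_gens_def)

section \<open>Shuffle relators \<open>shrel\<close> and stuffle relators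
  \<open>strel\<close>\<close>

definition shrel :: "nat \<Rightarrow> nat \<Rightarrow> nat \<Rightarrow> int \<Rightarrow> int \<Rightarrow> (dz_gen \<Rightarrow>\<^sub>0 rat)" where
  "shrel N r s a b = Pd N r s a b -
        ((\<Sum>j<r. dz_scale (of_nat ((s - 1 + j) choose j)) (Zd N (r - j) (s + j) (a - b) b)) +
         (\<Sum>j<s. dz_scale (of_nat ((r - 1 + j) choose j)) (Zd N (s - j) (r + j) (b - a) a)))"

definition strel :: "nat \<Rightarrow> nat \<Rightarrow> nat \<Rightarrow> int \<Rightarrow> int \<Rightarrow> (dz_gen \<Rightarrow>\<^sub>0 rat)" where
  "strel N r s a b = Pd N r s a b - (Zd N r s a b + Zd N s r b a + Zs N (r + s) (a + b))"

definition shrels :: "nat \<Rightarrow> nat \<Rightarrow> (dz_gen \<Rightarrow>\<^sub>0 rat) set" where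
  "shrels k N = {shrel N r s a b | r s a b. (r, s) \<in> rs_pairs k \<and> (a, b) \<in> pairsA N}"

definition strels :: "nat \<Rightarrow> nat \<Rightarrow> (dz_gen \<Rightarrow>\<^sub>0 rat) set" where
  "strels k N = {strel N r s a b | r s a b. (r, s) \<in> rs_pairs k \<and> (a, b) \<in> pairsA N}"

lemma dz_relators_eq: "dz_relators k N = shrels k N \<union> strels k N"
  by (simp add: dz_relators_def shrels_def strels_def shrel_def strel_def)

lemma strel_free:
  assumes "N \<ge> 1" "(r, s) \<in> rs_pairs k" "(a, b) \<in> pairsA N"
  shows "strel N r s a b \<in> dz_free k N"
proof -
  have "cop N a b" "cop N b a" "r + s = k"
    using assms by (auto simp: pairsA_iff rs_pairs_def cop_commute)
  then show ?thesis
    unfolding strel_def using assms(1,2)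
    by (auto intro!: dz.subspace_diff[OF subspace_dz_free] dz.subspace_add[OF subspace_dz_free]
        Pd_free Zd_free Zs_free simp: rs_pairs_swap)
qed

lemma shrel_free:
  assumes "N \<ge> 1" "(r, s) \<in> rs_pairs k" "(a, b) \<in> pairsA N"
  shows "shrel N r s a b \<in> dz_free k N"
proof -
  have *: "cop N a b" "cop N (a - b) b" "cop N (b - a) a"
    using assms by (auto simp: pairsA_iff cop_commute)
  show ?thesis
    unfolding shrel_def using assms(1,2) *
    by (auto intro!: dz.subspace_diff[OF subspace_dz_free] dz.subspace_add[OF subspace_dz_free]
        dz.subspace_sum[OF subspace_dz_free] dz.subspace_scale[OF subspace_dz_free]
        Pd_free Zd_free simp: rs_pairs_def)
qed

lemma same_swap: "same N a b c d = same N b a d c"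
  by (auto simp: same_def)

lemma same_uminus: "same N (- a) b c d = same N a b (- c) d" "same N a (- b) c d = same N a b c (- d)"
  by (auto simp: same_def) (metis cong_minus_minus_iff minus_minus)+

text \<open>The shear \<open>T\<close> acts on indices as it does on variables: a generator at
  \<open>(a - b, b)\<close> meets the index \<open>(c, d)\<close> exactly when \<open>(a, b)\<close>
  is congruent to \<open>T(c, d)\<close>.\<close>

lemma same_shear: "same N (a - b) b c d = same N a b (c + d) d"
proof -
  have "int N dvd a - b - c \<longleftrightarrow> int N dvd a - (c + d)" if "int N dvd b - d"
    using dvd_add_left_iff[OF that, of "a - b - c"] by (simp add: algebra_simps)
  then show ?thesis by (auto simp: same_def cong_iff_dvd_diff)
qed

text \<open>\<open>divmon_shuffle\<close> shears the variables and \<open>same_shear\<close> the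
  indices, so a P-part \<open>f\<close> goes with the Z-part \<open>- f|(1 + \<sigma>)T\<close>. In
  this form the relation is linear in the relator and passes to spans.\<close>

lemma zpart_shrel:
  assumes "(r, s) \<in> rs_pairs k"
  shows "zpart k N (shrel N r s a b) c d X Y =
    - (ppart k N (shrel N r s a b) (c + d) d (X + Y) Y + ppart k N (shrel N r s a b) d (c + d) Y (X + Y))"
proof -
  \<comment> \<open>One sum of the relator suffices; the other arises by exchanging \<open>r\<close>
    with \<open>s\<close> and \<open>a\<close> with \<open>b\<close>.\<close>
  have half: "zpart k N (\<Sum>j<r. dz_scale (of_nat ((s - 1 + j) choose j)) (Zd N (r - j) (s + j) (a - b) b)) c d X Y
      = (if same N a b (c + d) d then divmon r s (X + Y) Y else 0)"
    if rs: "(r, s) \<in> rs_pairs k" for r s a b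
  proof -
    have "zpart k N (\<Sum>j<r. dz_scale (of_nat ((s - 1 + j) choose j)) (Zd N (r - j) (s + j) (a - b) b)) c d X Y
      = (\<Sum>j<r. of_nat ((s - 1 + j) choose j) * (if same N (a - b) b c d then divmon (r - j) (s + j) X Y else 0))"
      unfolding zpart_sum zpart_linear using rs
      by (intro sum.cong refl arg_cong[where f = "\<lambda>t. _ * t"] zpart_Zd) (auto simp: rs_pairs_def)
    also have "\<dots> = (if same N (a - b) b c d then (\<Sum>j<r. of_nat ((s - 1 + j) choose j) * divmon (r - j) (s + j) X Y) else 0)"
      by simp
    also have "\<dots> = (if same N (a - b) b c d then divmon r s (X + Y) Y else 0)"
      using rs by (subst divmon_shuffle) (auto simp: rs_pairs_def)
    finally show ?thesis by (simp only: same_shear)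
  qed
  have P: "ppart k N (shrel N r s a b) c d X Y = (if same N a b c d then divmon r s X Y else 0)" for c d X Y
    by (simp add: shrel_def ppart_linear ppart_sum ppart_Pd[OF assms])
  have "zpart k N (shrel N r s a b) c d X Y =
     - ((if same N a b (c + d) d then divmon r s (X + Y) Y else 0) + (if same N b a (c + d) d then divmon s r (X + Y) Y else 0))"
    using half[of r s a b] half[of s r b a] assms by (simp add: shrel_def zpart_linear rs_pairs_swap)
  then show ?thesis by (simp add: P same_swap[of N b a] divmon_swap)
qed

lemma zpart_strel:
  assumes "(r, s) \<in> rs_pairs k"
  shows "zpart k N (strel N r s a b) c d X Y =
    - (ppart k N (strel N r s a b) c d X Y + ppart k N (strel N r s a b) d c Y X)"
  using assms
  by (simp add: strel_def zpart_linear ppart_linear zpart_Zd ppart_Pd rs_pairs_swap same_swap[of N b a] divmon_swap)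

lemma zpart_span_shrels:
  assumes "x \<in> dz.span (shrels k N)"
  shows "zpart k N x c d X Y = - (ppart k N x (c + d) d (X + Y) Y + ppart k N x d (c + d) Y (X + Y))"
  using assms
proof (induction rule: dz.span_induct_alt)
  case (step c x y)
  then show ?case by (auto simp: shrels_def zpart_linear ppart_linear zpart_shrel algebra_simps)
qed (simp add: zpart_linear ppart_linear)

lemma zpart_span_strels:
  assumes "x \<in> dz.span (strels k N)"
  shows "zpart k N x c d X Y = - (ppart k N x c d X Y + ppart k N x d c Y X)"
  using assms
proof (induction rule: dz.span_induct_alt)
  case (step c x y)
  then show ?case by (auto simp: strels_def zpart_linear ppart_linear zpart_strel algebra_simps)
qed (simp add: zpart_linear ppart_linear)

section \<open>The even subspace\<close>

definition evgen :: "nat \<Rightarrow> nat \<Rightarrow> nat \<Rightarrow> int \<Rightarrow> int \<Rightarrow> (dz_gen \<Rightarrow>\<^sub>0 rat)" where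
  "evgen N r s a b = Pd N r s a b + dz_scale ((-1)^r) (Pd N r s (- a) b)
        + dz_scale ((-1)^s) (Pd N r s a (- b)) + dz_scale ((-1)^(r + s)) (Pd N r s (- a) (- b))"

definition evgens :: "nat \<Rightarrow> nat \<Rightarrow> (dz_gen \<Rightarrow>\<^sub>0 rat) set" where
  "evgens k N = {evgen N r s a b | r s a b. (r, s) \<in> rs_pairs k \<and> (a, b) \<in> pairsA N} \<union>
     {Zs N k a + dz_scale ((-1)^k) (Zs N k (- a)) | a. a \<in> {0..<int N}}"

lemma evgen_free:
  assumes "N \<ge> 1" "(r, s) \<in> rs_pairs k" "(a, b) \<in> pairsA N"
  shows "evgen N r s a b \<in> dz_free k N"
  unfolding evgen_def using assms
  by (auto intro!: dz.subspace_add[OF subspace_dz_free] dz.subspace_scale[OF subspace_dz_free] Pd_free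
        simp: pairsA_iff)

lemma span_evgens_free:
  assumes "N \<ge> 1"
  shows "dz.span (evgens k N) \<subseteq> dz_free k N"
proof (rule dz.span_minimal[OF _ subspace_dz_free])
  show "evgens k N \<subseteq> dz_free k N"
    using assms by (auto simp: evgens_def evgen_free intro!: dz.subspace_add[OF subspace_dz_free]
        dz.subspace_scale[OF subspace_dz_free] Zs_free)
qed

lemma dz_class_eq_iff:
  assumes "x \<in> dz_free k N" "y \<in> dz_free k N"
  shows "dz_class k N x = dz_class k N y \<longleftrightarrow> x - y \<in> dz.span (dz_relators k N)"
  unfolding dz_class_def using eq_equiv_class_iff[OF equiv_dz_rel assms] assms
  by (simp add: dz_rel_def)

text \<open>Moves membership from the quotient to the free space, where the parts of an element can
  be compared.\<close>

lemma P_ev_iff: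
  assumes "N \<ge> 1" "x \<in> dz_free k N"
  shows "dz_class k N x \<in> P_ev k N \<longleftrightarrow> (\<exists>y\<in>dz.span (evgens k N). x - y \<in> dz.span (dz_relators k N))"
proof -
  have "P_ev k N = dz_class k N ` dz.span (evgens k N)"
    by (simp add: P_ev_def evgens_def evgen_def)
  then show ?thesis
    using dz_class_eq_iff[OF assms(2)] span_evgens_free[OF assms(1)] by (auto simp: image_iff subset_iff)
qed

text \<open>The four summands are the sign changes of the two coordinates, and the shift of
  exponents turns \<open>(-1) ^ r\<close> and \<open>(-1) ^ s\<close> into -1. So the P-part of
  \<open>Pd N r s a b\<close> is acted on by \<open>(1 - \<delta>)(1 - \<delta>')\<close> with
  \<open>\<delta>' = diag(1, -1)\<close>.\<close>

lemma evgen_parts: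
  assumes "(r, s) \<in> rs_pairs k"
  shows "ppart k N (evgen N r s a b) c d X Y =
     ppart k N (Pd N r s a b) c d X Y - ppart k N (Pd N r s a b) (- c) d (- X) Y
     - ppart k N (Pd N r s a b) c (- d) X (- Y) + ppart k N (Pd N r s a b) (- c) (- d) (- X) (- Y)"
    "zpart k N (evgen N r s a b) c d X Y = 0" "lk (evgen N r s a b) (GenZs j t) = 0"
proof -
  have rs: "r \<ge> 1" "s \<ge> 1" using assms by (auto simp: rs_pairs_def)
  have 2: "divmon r s X (- Y) = - ((- 1) ^ s * divmon r s X Y)" for X Y
    using divmon_uminus[OF rs(2), of r Y X] by (simp add: divmon_swap[of s r])
  show "ppart k N (evgen N r s a b) c d X Y =
     ppart k N (Pd N r s a b) c d X Y - ppart k N (Pd N r s a b) (- c) d (- X) Y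
     - ppart k N (Pd N r s a b) c (- d) X (- Y) + ppart k N (Pd N r s a b) (- c) (- d) (- X) (- Y)"
    by (simp add: evgen_def ppart_linear ppart_Pd[OF assms] same_uminus divmon_uminus[OF rs(1)] 2 power_add)
  show "zpart k N (evgen N r s a b) c d X Y = 0" "lk (evgen N r s a b) (GenZs j t) = 0"
    by (simp_all add: evgen_def zpart_linear lookup_add)
qed

text \<open>Either sign change negates \<open>(1 - \<delta>)(1 - \<delta>')\<close>, and the single
  zeta generators contribute to neither part.\<close>

lemma span_evgens_parts:
  assumes "x \<in> dz.span (evgens k N)"
  shows "zpart k N x c d X Y = 0"
    and "ppart k N x (- c) d (- X) Y = - ppart k N x c d X Y"
    and "ppart k N x c (- d) X (- Y) = - ppart k N x c d X Y"
proof -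
  have "zpart k N x c d X Y = 0 \<and> ppart k N x (- c) d (- X) Y = - ppart k N x c d X Y
      \<and> ppart k N x c (- d) X (- Y) = - ppart k N x c d X Y"
    using assms
  proof (induction rule: dz.span_induct_alt)
    case (step c x y)
    then show ?case by (auto simp: evgens_def zpart_linear ppart_linear evgen_parts algebra_simps)
  qed (simp add: zpart_linear ppart_linear)
  then show "zpart k N x c d X Y = 0"
    and "ppart k N x (- c) d (- X) Y = - ppart k N x c d X Y"
    and "ppart k N x c (- d) X (- Y) = - ppart k N x c d X Y" by auto
qed

section \<open>Cosets of the group \<open>\<Gamma>\<^sub>1(N)\<close>\<close>

lemma mat2_nth [simp]:
  "mat2 a b c d $ 1 $ 1 = a" "mat2 a b c d $ 1 $ 2 = b" "mat2 a b c d $ 2 $ 1 = c" "mat2 a b c d $ 2 $ 2 = d"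
  by (simp_all add: mat2_def)

lemma mat2_eta: "mat2 (m $ 1 $ 1) (m $ 1 $ 2) (m $ 2 $ 1) (m $ 2 $ 2) = m"
  by (simp add: vec_eq_iff forall_2)

lemma mat2_mult: "mat2 a b c d ** mat2 a' b' c' d' =
    mat2 (a * a' + b * c') (a * b' + b * d') (c * a' + d * c') (c * b' + d * d')"
  by (simp add: vec_eq_iff forall_2 matrix_matrix_mult_def sum_2)

lemma mat_1_eq: "mat 1 = mat2 1 0 0 1"
  by (simp add: vec_eq_iff forall_2 mat_def)

lemma SL2Z_iff: "m \<in> SL2Z \<longleftrightarrow> m $ 1 $ 1 * m $ 2 $ 2 - m $ 1 $ 2 * m $ 2 $ 1 = 1"
  by (simp add: SL2Z_def det_2)

lemma SL2Z_mult: "m \<in> SL2Z \<Longrightarrow> n \<in> SL2Z \<Longrightarrow> m ** n \<in> SL2Z"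
  by (simp add: SL2Z_def det_mul)

lemma mat_mult_nth:
  "(m ** n) $ i $ j = m $ i $ 1 * n $ 1 $ j + m $ i $ 2 * n $ 2 $ j" for m n :: "int^2^2"
  by (simp add: matrix_matrix_mult_def sum_2)

definition adj :: "int^2^2 \<Rightarrow> int^2^2" where
  "adj g = mat2 (g $ 2 $ 2) (- g $ 1 $ 2) (- g $ 2 $ 1) (g $ 1 $ 1)"

lemma adj_SL2Z: "g \<in> SL2Z \<Longrightarrow> adj g \<in> SL2Z"
  by (simp add: SL2Z_iff adj_def algebra_simps)

lemma adj_mult:
  assumes "g \<in> SL2Z" shows "g ** adj g = mat 1" "adj g ** g = mat 1"
  using assms by (simp_all add: SL2Z_iff adj_def mat_1_eq vec_eq_iff forall_2 mat_mult_nth algebra_simps)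

text \<open>\<open>matrix_inv\<close> is given by a choice operator, so it is identified through
  uniqueness of inverses.\<close>

lemma matrix_inv_SL2Z:
  assumes "g \<in> SL2Z" shows "matrix_inv g = adj g"
proof -
  have inv: "g ** matrix_inv g = mat 1 \<and> matrix_inv g ** g = mat 1"
    unfolding matrix_inv_def by (rule someI[of _ "adj g"]) (simp add: adj_mult assms)
  have "matrix_inv g = (matrix_inv g ** g) ** adj g"
    by (simp add: matrix_mul_assoc[symmetric] adj_mult assms)
  then show ?thesis using inv by simp
qed

section \<open>Cosets as residue classes of bottom rows\<close>

definition rowclass :: "nat \<Rightarrow> int \<Rightarrow> int \<Rightarrow> (int^2^2) set" where
  "rowclass N c d = {m \<in> SL2Z. [m $ 2 $ 1 = c] (mod int N) \<and> [m $ 2 $ 2 = d] (mod int N)}"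

text \<open>Left multiplication by \<open>Gamma1 N\<close> fixes the bottom row modulo
  \<open>N\<close>. Conversely, if \<open>m\<close> and \<open>g\<close> have congruent bottom rows,
  that of \<open>m ** adj g\<close> is congruent to \<open>(0, 1)\<close>, and determinant 1 settles
  its upper left entry.\<close>

lemma Gamma1_orbit:
  assumes "g \<in> SL2Z"
  shows "(\<lambda>h. h ** g) ` Gamma1 N = rowclass N (g $ 2 $ 1) (g $ 2 $ 2)"
proof (intro equalityI subsetI)
  fix m assume "m \<in> (\<lambda>h. h ** g) ` Gamma1 N"
  then obtain h where h: "h \<in> Gamma1 N" "m = h ** g" by auto
  then have "[h $ 2 $ 1 * g $ 1 $ j + h $ 2 $ 2 * g $ 2 $ j = 0 * g $ 1 $ j + 1 * g $ 2 $ j] (mod int N)" for j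
    by (intro cong_add cong_mult cong_refl) (auto simp: Gamma1_def)
  then show "m \<in> rowclass N (g $ 2 $ 1) (g $ 2 $ 2)"
    using h assms by (auto simp: rowclass_def mat_mult_nth SL2Z_mult Gamma1_def)
next
  fix m assume m: "m \<in> rowclass N (g $ 2 $ 1) (g $ 2 $ 2)"
  define h where "h = m ** adj g"
  have SL: "h \<in> SL2Z" using m assms by (auto simp: h_def rowclass_def SL2Z_mult adj_SL2Z)
  have dg: "g $ 1 $ 1 * g $ 2 $ 2 - g $ 1 $ 2 * g $ 2 $ 1 = 1" using assms by (simp add: SL2Z_iff)
  have "h $ 2 $ 1 = m $ 2 $ 1 * g $ 2 $ 2 - m $ 2 $ 2 * g $ 2 $ 1"
    by (simp add: h_def mat_mult_nth adj_def)
  also have "[\<dots> = g $ 2 $ 1 * g $ 2 $ 2 - g $ 2 $ 2 * g $ 2 $ 1] (mod int N)"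
    using m by (intro cong_diff cong_mult cong_refl) (auto simp: rowclass_def)
  finally have h21: "[h $ 2 $ 1 = 0] (mod int N)" by (simp add: mult.commute)
  have "h $ 2 $ 2 = m $ 2 $ 2 * g $ 1 $ 1 - m $ 2 $ 1 * g $ 1 $ 2"
    by (simp add: h_def mat_mult_nth adj_def)
  also have "[\<dots> = g $ 2 $ 2 * g $ 1 $ 1 - g $ 2 $ 1 * g $ 1 $ 2] (mod int N)"
    using m by (intro cong_diff cong_mult cong_refl) (auto simp: rowclass_def)
  finally have h22: "[h $ 2 $ 2 = 1] (mod int N)" using dg by (simp add: mult.commute)
  have "[h $ 1 $ 1 * 1 - h $ 1 $ 2 * 0 = h $ 1 $ 1 * h $ 2 $ 2 - h $ 1 $ 2 * h $ 2 $ 1] (mod int N)"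
    using h21 h22 by (intro cong_diff cong_mult cong_refl) (auto intro: cong_sym)
  then have "h \<in> Gamma1 N" using SL h21 h22 by (simp add: Gamma1_def SL2Z_iff)
  moreover have "m = h ** g"
    by (simp add: h_def matrix_mul_assoc[symmetric] adj_mult assms)
  ultimately show "m \<in> (\<lambda>h. h ** g) ` Gamma1 N" by blast
qed

lemma cop_SL2Z: "g \<in> SL2Z \<Longrightarrow> cop N (g $ 2 $ 1) (g $ 2 $ 2)"
proof -
  assume "g \<in> SL2Z"
  then have "g $ 1 $ 1 * g $ 2 $ 2 - g $ 1 $ 2 * g $ 2 $ 1 = 1" by (simp add: SL2Z_iff)
  then have "gcd (g $ 2 $ 1) (g $ 2 $ 2) dvd 1"
    by (metis dvd_diff dvd_mult gcd_dvd1 gcd_dvd2)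
  then have "gcd (g $ 2 $ 1) (g $ 2 $ 2) = 1" by simp
  then show ?thesis by (simp add: cop_def)
qed

text \<open>Take for \<open>t\<close> the product of the primes dividing \<open>a\<close> but not
  \<open>b\<close>. Each prime divisor of \<open>a\<close> then divides exactly one of
  \<open>b\<close> and \<open>t * n\<close>: if it divides \<open>b\<close>, it divides neither
  \<open>t\<close> nor, by the gcd condition, \<open>n\<close>.\<close>

lemma coprime_shift_exists:
  fixes a b n :: int
  assumes "a \<noteq> 0" "gcd (gcd a b) n = 1"
  shows "\<exists>t. coprime a (b + t * n)"
proof -
  define S where "S = {p. prime p \<and> p dvd a \<and> \<not> p dvd b}"
  have fin: "finite S"
    by (rule finite_subset[OF _ finite_divisors_int[OF assms(1)]]) (auto simp: S_def)
  have "coprime a (b + \<Prod>S * n)"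
  proof (rule ccontr)
    assume "\<not> coprime a (b + \<Prod>S * n)"
    then have "\<not> is_unit (gcd a (b + \<Prod>S * n))" by (simp add: coprime_iff_gcd_eq_1)
    moreover have "gcd a (b + \<Prod>S * n) \<noteq> 0" using assms by simp
    ultimately obtain p where p: "prime p" "p dvd gcd a (b + \<Prod>S * n)"
      using prime_divisorE by blast
    then have pa: "p dvd a" and pb: "p dvd b + \<Prod>S * n" by auto
    show False
    proof (cases "p dvd b")
      case True
      with pb have "p dvd \<Prod>S * n" by (simp add: dvd_add_right_iff)
      moreover have "\<not> p dvd n"
      proof
        assume "p dvd n"
        then have "p dvd gcd (gcd a b) n" using pa True by simp
        then show False using assms(2) p(1) by (metis not_prime_unit)
      qed
      ultimately have "p dvd \<Prod>S" using p(1) by (simp add: prime_dvd_mult_iff)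
      then obtain q where "q \<in> S" "p dvd q" using p(1) fin by (auto simp: prime_dvd_prod_iff)
      then show False using p(1) True by (auto simp: S_def dest: primes_dvd_imp_eq)
    next
      case False
      then have "p \<in> S" using p pa by (simp add: S_def)
      then have "p dvd \<Prod>S" using dvd_prodI[OF fin, of p "\<lambda>q. q"] by simp
      then show False using pb False by (simp add: dvd_add_left_iff)
    qed
  qed
  then show ?thesis by blast
qed

text \<open>Surjectivity of reduction from SL(2,Z) to A(N): \<open>d\<close> is shifted to an
  integer coprime to a lift of \<open>c\<close>, and a Bezout relation supplies the upper
  row.\<close>

lemma rowclass_nonempty:
  assumes "N \<ge> 1" "cop N c d"
  shows "rowclass N c d \<noteq> {}"
proof -
  \<comment> \<open>\<open>coprime_shift_exists\<close> needs a nonzero entry, so 0 is replaced by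
    the congruent \<open>int N\<close>.\<close>
  define c' where "c' = (if c = 0 then int N else c)"
  have c': "[c' = c] (mod int N)" "c' \<noteq> 0" using assms by (auto simp: c'_def cong_def)
  then have "cop N c' d" using assms(2) cop_cong[OF c'(1) cong_refl] by blast
  then obtain t where "coprime c' (d + t * int N)"
    using coprime_shift_exists[OF c'(2), of d "int N"] by (auto simp: cop_def)
  then obtain u v where uv: "u * c' + v * (d + t * int N) = 1"
    by (metis bezout_int coprime_imp_gcd_eq_1)
  have "mat2 v (- u) c' (d + t * int N) \<in> rowclass N c d"
    using uv c' by (auto simp: rowclass_def SL2Z_iff cong_def)
  then show ?thesis by blast
qed

lemma rowclass_cong: "same N c d c' d' \<Longrightarrow> rowclass N c d = rowclass N c' d'"
  by (auto simp: rowclass_def same_def intro: cong_trans cong_sym)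

lemma cosets_Gamma1:
  assumes "N \<ge> 1"
  shows "cosets (Gamma1 N) = {rowclass N c d | c d. cop N c d}"
proof (intro equalityI subsetI)
  fix C assume "C \<in> cosets (Gamma1 N)"
  then show "C \<in> {rowclass N c d | c d. cop N c d}"
    by (auto simp: cosets_def Gamma1_orbit) (metis cop_SL2Z)
next
  fix C assume "C \<in> {rowclass N c d | c d. cop N c d}"
  then obtain c d where C: "C = rowclass N c d" "cop N c d" by blast
  then obtain g where g: "g \<in> rowclass N c d" using rowclass_nonempty[OF assms] by blast
  then have "rowclass N c d = (\<lambda>h. h ** g) ` Gamma1 N"
    by (subst Gamma1_orbit) (auto simp: rowclass_def same_def intro: cong_trans cong_sym)
  then show "C \<in> cosets (Gamma1 N)" using g C by (auto simp: cosets_def rowclass_def)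
qed

lemma ball_cosets:
  assumes "N \<ge> 1"
  shows "(\<forall>C\<in>cosets (Gamma1 N). Q C) \<longleftrightarrow> (\<forall>c d. cop N c d \<longrightarrow> Q (rowclass N c d))"
  unfolding cosets_Gamma1[OF assms] by auto

lemma coset_of_eq:
  assumes "N \<ge> 1" "cop N c d"
  shows "coset_of N c d = rowclass N c d"
  unfolding coset_of_def
proof (rule the_equality)
  show "rowclass N c d \<in> cosets (Gamma1 N) \<and> (\<exists>g\<in>rowclass N c d. [g $ 2 $ 1 = c] (mod int N) \<and> [g $ 2 $ 2 = d] (mod int N))"
    using rowclass_nonempty[OF assms] assms by (auto simp: cosets_Gamma1 rowclass_def)
  fix C assume "C \<in> cosets (Gamma1 N) \<and> (\<exists>g\<in>C. [g $ 2 $ 1 = c] (mod int N) \<and> [g $ 2 $ 2 = d] (mod int N))"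
  then obtain c' d' g where g: "C = rowclass N c' d'" "g \<in> C" "same N (g $ 2 $ 1) (g $ 2 $ 2) c d"
    using assms by (auto simp: cosets_Gamma1 same_def)
  then have "same N (g $ 2 $ 1) (g $ 2 $ 2) c' d'" by (auto simp: rowclass_def same_def)
  then show "C = rowclass N c d" using rowclass_cong g by metis
qed

lemma coset_of_mod: "coset_of N (c mod int N) (d mod int N) = coset_of N c d"
  by (simp add: coset_of_def)

text \<open>The row \<open>(c, d)\<close> is multiplied by \<open>adj g\<close>. Multiplying the
  result by \<open>g\<close> gives back \<open>(c, d)\<close>, which yields the reverse
  inclusion.\<close>

lemma rowclass_times:
  assumes "g \<in> SL2Z"
  shows "(\<lambda>m. m ** matrix_inv g) ` rowclass N c d =
      rowclass N (c * g $ 2 $ 2 - d * g $ 2 $ 1) (d * g $ 1 $ 1 - c * g $ 1 $ 2)"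
proof (intro equalityI subsetI)
  fix m assume "m \<in> (\<lambda>m. m ** matrix_inv g) ` rowclass N c d"
  then obtain n where n: "n \<in> rowclass N c d" "m = n ** adj g" by (auto simp: matrix_inv_SL2Z assms)
  have "[n $ 2 $ 1 * g $ 2 $ 2 - n $ 2 $ 2 * g $ 2 $ 1 = c * g $ 2 $ 2 - d * g $ 2 $ 1] (mod int N)"
    "[n $ 2 $ 2 * g $ 1 $ 1 - n $ 2 $ 1 * g $ 1 $ 2 = d * g $ 1 $ 1 - c * g $ 1 $ 2] (mod int N)"
    using n by (auto intro!: cong_diff cong_mult simp: rowclass_def)
  then show "m \<in> rowclass N (c * g $ 2 $ 2 - d * g $ 2 $ 1) (d * g $ 1 $ 1 - c * g $ 1 $ 2)"
    using n assms by (simp add: rowclass_def SL2Z_mult adj_SL2Z mat_mult_nth) (simp add: adj_def)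
next
  let ?c = "c * g $ 2 $ 2 - d * g $ 2 $ 1" and ?d = "d * g $ 1 $ 1 - c * g $ 1 $ 2"
  fix m assume m: "m \<in> rowclass N ?c ?d"
  have det: "g $ 1 $ 1 * g $ 2 $ 2 - g $ 1 $ 2 * g $ 2 $ 1 = 1" using assms by (simp add: SL2Z_iff)
  have "?c * g $ 1 $ 1 + ?d * g $ 2 $ 1 = c * (g $ 1 $ 1 * g $ 2 $ 2 - g $ 1 $ 2 * g $ 2 $ 1)"
    "?c * g $ 1 $ 2 + ?d * g $ 2 $ 2 = d * (g $ 1 $ 1 * g $ 2 $ 2 - g $ 1 $ 2 * g $ 2 $ 1)"
    by (simp_all add: algebra_simps)
  then have e: "?c * g $ 1 $ 1 + ?d * g $ 2 $ 1 = c" "?c * g $ 1 $ 2 + ?d * g $ 2 $ 2 = d"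
    unfolding det by simp_all
  have "[m $ 2 $ 1 * g $ 1 $ 1 + m $ 2 $ 2 * g $ 2 $ 1 = ?c * g $ 1 $ 1 + ?d * g $ 2 $ 1] (mod int N)"
    "[m $ 2 $ 1 * g $ 1 $ 2 + m $ 2 $ 2 * g $ 2 $ 2 = ?c * g $ 1 $ 2 + ?d * g $ 2 $ 2] (mod int N)"
    using m by (auto intro!: cong_add cong_mult simp: rowclass_def)
  then have "m ** g \<in> rowclass N c d"
    using m assms unfolding e by (simp add: rowclass_def SL2Z_mult mat_mult_nth)
  moreover have "m = (m ** g) ** matrix_inv g"
    by (simp add: matrix_inv_SL2Z assms matrix_mul_assoc[symmetric] adj_mult)
  ultimately show "m \<in> (\<lambda>m. m ** matrix_inv g) ` rowclass N c d" by blast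
qed

text \<open>Conjugation by \<open>mat_eps\<close> negates the off-diagonal entries and is an
  involution, so one inclusion, taken at \<open>- c\<close>, gives the other.\<close>

lemma rowclass_eps: "(\<lambda>m. mat_eps ** m ** mat_eps) ` rowclass N c d = rowclass N (- c) d"
proof -
  have eps: "mat_eps ** m ** mat_eps = mat2 (m $ 1 $ 1) (- m $ 1 $ 2) (- m $ 2 $ 1) (m $ 2 $ 2)" for m
    by (simp add: vec_eq_iff forall_2 mat_mult_nth mat_eps_def)
  have sub: "(\<lambda>m. mat_eps ** m ** mat_eps) ` rowclass N c d \<subseteq> rowclass N (- c) d" for c
    by (auto simp: eps rowclass_def SL2Z_iff cong_minus_minus_iff)
  have "m \<in> (\<lambda>m. mat_eps ** m ** mat_eps) ` rowclass N c d" if "m \<in> rowclass N (- c) d" for m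
  proof (rule image_eqI)
    show "m = mat_eps ** (mat_eps ** m ** mat_eps) ** mat_eps"
      by (simp add: eps mat2_eta)
    show "mat_eps ** m ** mat_eps \<in> rowclass N c d" using sub[of "- c"] that by auto
  qed
  with sub show ?thesis by blast
qed

section \<open>Period polynomials as functions on pairs\<close>

definition val :: "nat \<Rightarrow> ((int^2^2) set \<Rightarrow> rat poly poly) \<Rightarrow> int \<Rightarrow> int \<Rightarrow> rat \<Rightarrow> rat \<Rightarrow> rat" where
  "val N P c d x y = ev (P (rowclass N c d)) x y"

lemma ev_poly_act: "ev (poly_act g p) x y =
    ev p (of_int (g $ 1 $ 1) * x + of_int (g $ 1 $ 2) * y) (of_int (g $ 2 $ 1) * x + of_int (g $ 2 $ 2) * y)"
  by (simp add: poly_act_def ev_subst_XY)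

lemma ev_slash:
  assumes "N \<ge> 1" "cop N c d" "g \<in> SL2Z"
  shows "ev (slash (Gamma1 N) g P (rowclass N c d)) x y =
    val N P (c * g $ 2 $ 2 - d * g $ 2 $ 1) (d * g $ 1 $ 1 - c * g $ 1 $ 2)
      (of_int (g $ 1 $ 1) * x + of_int (g $ 1 $ 2) * y) (of_int (g $ 2 $ 1) * x + of_int (g $ 2 $ 2) * y)"
proof -
  have "rowclass N c d \<in> cosets (Gamma1 N)" using assms by (auto simp: cosets_Gamma1)
  then show ?thesis by (simp add: slash_def ev_poly_act rowclass_times assms val_def)
qed

lemma ev_slash_eps:
  assumes "N \<ge> 1" "cop N c d"
  shows "ev (slash_eps (Gamma1 N) P (rowclass N c d)) x y = val N P (- c) d (- x) y"
proof -
  have "rowclass N c d \<in> cosets (Gamma1 N)" using assms by (auto simp: cosets_Gamma1)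
  then show ?thesis by (simp add: slash_eps_def ev_poly_act rowclass_eps val_def) (simp add: mat_eps_def)
qed

text \<open>Invariance under \<open>mat_J\<close>, the eigenvalue of \<epsilon> and the two period
  relations, read off on bottom rows. The factor \<open>(-1) ^ w\<close> covers both parities in
  \<open>Wbar_plus\<close> at once.\<close>

lemma Wbar_plus_iff:
  assumes "N \<ge> 1"
  shows "P \<in> Wbar_plus (Gamma1 N) w \<longleftrightarrow> P \<in> Vtilde (Gamma1 N) w \<and>
    (\<forall>c d x y. cop N c d \<longrightarrow>
      val N P (- c) (- d) (- x) (- y) = val N P c d x y \<and>
      val N P (- c) d (- x) y = (-1) ^ w * val N P c d x y \<and>
      val N P c d x y + val N P (- d) c (- y) x = 0 \<and>
      val N P c d x y + val N P (- d) (c + d) (x - y) x + val N P (- c - d) c (- y) (x - y) = 0)"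
proof -
  have SL: "mat_J \<in> SL2Z" "mat_S \<in> SL2Z" "mat_U \<in> SL2Z" "mat_U ** mat_U \<in> SL2Z"
    by (simp_all add: SL2Z_iff mat_J_def mat_S_def mat_U_def mat_mult_nth)
  have J: "slash (Gamma1 N) mat_J P = P \<longleftrightarrow>
      (\<forall>c d x y. cop N c d \<longrightarrow> val N P (- c) (- d) (- x) (- y) = val N P c d x y)"
    if "P \<in> Vtilde (Gamma1 N) w"
  proof -
    \<comment> \<open>Both sides are extensional on the cosets, so it is enough to compare them
      there.\<close>
    have "slash (Gamma1 N) mat_J P = P \<longleftrightarrow>
      (\<forall>C\<in>cosets (Gamma1 N). slash (Gamma1 N) mat_J P C = P C)"
    proof
      assume *: "\<forall>C\<in>cosets (Gamma1 N). slash (Gamma1 N) mat_J P C = P C"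
      show "slash (Gamma1 N) mat_J P = P"
        by (rule extensionalityI[of _ "cosets (Gamma1 N)"])
           (use * that in \<open>auto simp: Vtilde_def PiE_def slash_def\<close>)
    qed auto
    also have "\<dots> \<longleftrightarrow> (\<forall>c d. cop N c d \<longrightarrow> (\<forall>x y. ev (slash (Gamma1 N) mat_J P (rowclass N c d)) x y = ev (P (rowclass N c d)) x y))"
      by (simp add: ball_cosets[OF assms] ev_eq_iff del: ev_simps)
    finally show ?thesis by (auto simp: ev_slash[OF assms _ SL(1)]) (auto simp: mat_J_def val_def)
  qed
  have S: "(\<forall>C\<in>cosets (Gamma1 N). P C + slash (Gamma1 N) mat_S P C = 0) \<longleftrightarrow>
     (\<forall>c d x y. cop N c d \<longrightarrow> val N P c d x y + val N P (- d) c (- y) x = 0)"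
  proof -
    have "(\<forall>C\<in>cosets (Gamma1 N). P C + slash (Gamma1 N) mat_S P C = 0) \<longleftrightarrow>
      (\<forall>c d. cop N c d \<longrightarrow> (\<forall>x y. ev (P (rowclass N c d) + slash (Gamma1 N) mat_S P (rowclass N c d)) x y = ev 0 x y))"
      by (simp add: ball_cosets[OF assms] ev_eq_iff del: ev_simps)
    then show ?thesis by (auto simp: ev_slash[OF assms _ SL(2)]) (auto simp: mat_S_def val_def)
  qed
  have U: "(\<forall>C\<in>cosets (Gamma1 N). P C + slash (Gamma1 N) mat_U P C + slash (Gamma1 N) (mat_U ** mat_U) P C = 0) \<longleftrightarrow>
     (\<forall>c d x y. cop N c d \<longrightarrow>
       val N P c d x y + val N P (- d) (c + d) (x - y) x + val N P (- c - d) c (- y) (x - y) = 0)"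
  proof -
    have "(\<forall>C\<in>cosets (Gamma1 N). P C + slash (Gamma1 N) mat_U P C + slash (Gamma1 N) (mat_U ** mat_U) P C = 0) \<longleftrightarrow>
      (\<forall>c d. cop N c d \<longrightarrow> (\<forall>x y. ev (P (rowclass N c d) + slash (Gamma1 N) mat_U P (rowclass N c d)
         + slash (Gamma1 N) (mat_U ** mat_U) P (rowclass N c d)) x y = ev 0 x y))"
      by (simp add: ball_cosets[OF assms] ev_eq_iff del: ev_simps)
    moreover have UU: "mat_U ** mat_U = mat2 0 (- 1) 1 (- 1)" by (simp add: mat_U_def mat2_mult)
    moreover have SLUU: "mat2 0 (- 1) 1 (- 1) \<in> SL2Z" by (simp add: SL2Z_iff)
    ultimately show ?thesis
      by (simp add: ev_slash[OF assms _ SL(3)] ev_slash[OF assms _ SLUU])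
         (simp add: mat_U_def val_def add.commute)
  qed
  have E: "(\<forall>C\<in>cosets (Gamma1 N). slash_eps (Gamma1 N) P C = (if even w then P C else - P C)) \<longleftrightarrow>
     (\<forall>c d x y. cop N c d \<longrightarrow> val N P (- c) d (- x) y = (-1) ^ w * val N P c d x y)"
  proof -
    have "(\<forall>C\<in>cosets (Gamma1 N). slash_eps (Gamma1 N) P C = (if even w then P C else - P C)) \<longleftrightarrow>
      (\<forall>c d. cop N c d \<longrightarrow> (\<forall>x y. ev (slash_eps (Gamma1 N) P (rowclass N c d)) x y =
        ev (if even w then P (rowclass N c d) else - P (rowclass N c d)) x y))"
      by (simp add: ball_cosets[OF assms] ev_eq_iff del: ev_simps)
    then show ?thesis by (cases "even w") (simp_all add: ev_slash_eps[OF assms] val_def)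
  qed
  have "P \<in> Wbar_plus (Gamma1 N) w \<longleftrightarrow> P \<in> Vtilde (Gamma1 N) w \<and> slash (Gamma1 N) mat_J P = P \<and>
     (\<forall>C\<in>cosets (Gamma1 N). slash_eps (Gamma1 N) P C = (if even w then P C else - P C)) \<and>
     (\<forall>C\<in>cosets (Gamma1 N). P C + slash (Gamma1 N) mat_S P C = 0) \<and>
     (\<forall>C\<in>cosets (Gamma1 N). P C + slash (Gamma1 N) mat_U P C + slash (Gamma1 N) (mat_U ** mat_U) P C = 0)"
    by (auto simp: Wbar_plus_def WGamma_plus_def WGamma_minus_def WGamma_def VGamma_def)
  then show ?thesis using J S U E by blast
qed

lemma val_Vtilde:
  assumes "N \<ge> 1" "P \<in> Vtilde (Gamma1 N) w" "cop N c d"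
  shows "homog w (val N P c d)"
proof -
  have "rowclass N c d \<in> cosets (Gamma1 N)" using assms by (auto simp: cosets_Gamma1)
  then have "P (rowclass N c d) \<in> V w" using assms(2) by (auto simp: Vtilde_def)
  then show ?thesis by (auto simp: homog_def val_def)
qed

text \<open>A form is chosen for each coset; periodicity makes it independent of the pair naming the
  coset.\<close>

lemma Vtilde_exists:
  assumes "N \<ge> 1" and hom: "\<And>c d. homog w (F c d)"
    and per: "\<And>c d c' d'. same N c d c' d' \<Longrightarrow> F c d = F c' d'"
  obtains P where "P \<in> Vtilde (Gamma1 N) w" "\<And>c d. cop N c d \<Longrightarrow> val N P c d = F c d"
proof -
  have ex: "\<exists>p. p \<in> V w \<and> (\<forall>c d. cop N c d \<and> C = rowclass N c d \<longrightarrow> ev p = F c d)"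
    if inC: "C \<in> cosets (Gamma1 N)" for C
  proof -
    obtain c d where C: "C = rowclass N c d" "cop N c d" using inC unfolding cosets_Gamma1[OF assms(1)] by blast
    obtain p where p: "p \<in> V w" "ev p = F c d" using hom[of c d] by (force simp: homog_def)
    \<comment> \<open>A nonempty class determines its index modulo \<open>N\<close>, since any
      matrix in it exhibits both pairs.\<close>
    have "F c' d' = F c d" if "rowclass N c' d' = rowclass N c d" for c' d'
    proof -
      obtain m where "m \<in> rowclass N c d" using rowclass_nonempty[OF assms(1) C(2)] by blast
      then have "m \<in> rowclass N c d" "m \<in> rowclass N c' d'" using that by auto
      then have "same N c' d' c d" by (auto simp: rowclass_def same_def intro: cong_trans cong_sym)
      then show ?thesis by (rule per)
    qed
    then show ?thesis using p C by metis
  qed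
  define P where "P = (\<lambda>C\<in>cosets (Gamma1 N).
    SOME p. p \<in> V w \<and> (\<forall>c d. cop N c d \<and> C = rowclass N c d \<longrightarrow> ev p = F c d))"
  have P: "P C \<in> V w \<and> (\<forall>c d. cop N c d \<and> C = rowclass N c d \<longrightarrow> ev (P C) = F c d)"
    if "C \<in> cosets (Gamma1 N)" for C
  proof -
    have PC: "P C = (SOME p. p \<in> V w \<and> (\<forall>c d. cop N c d \<and> C = rowclass N c d \<longrightarrow> ev p = F c d))"
      using that by (simp add: P_def)
    show ?thesis unfolding PC by (rule someI_ex[OF ex[OF that]])
  qed
  show thesis
  proof
    show "P \<in> Vtilde (Gamma1 N) w" using P by (auto simp: Vtilde_def P_def)
    show "val N P c d = F c d" if "cop N c d" for c d
    proof -
      have "rowclass N c d \<in> cosets (Gamma1 N)" unfolding cosets_Gamma1[OF assms(1)] using that by blast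
      from P[OF this] that show ?thesis by (intro ext) (simp add: val_def)
    qed
  qed
qed

section \<open>Generating functions of the coefficients attached to a period polynomial\<close>

lemma hpoly_qcoeff:
  assumes "N \<ge> 1" "P \<in> Vtilde (Gamma1 N) w" "cop N a b"
  shows "hpoly (w + 2) (\<lambda>r s. qcoeff N P r s a b) x y = val N P a (b - a) (x - y) x"
proof -
  have cop: "cop N a (- a + b)" using assms(3) by simp
  have "rowclass N a (- a + b) \<in> cosets (Gamma1 N)" using cop by (auto simp: cosets_Gamma1[OF assms(1)] simp del: cop_add)
  then have "P (coset_of N a (- a + b)) \<in> V w"
    unfolding coset_of_eq[OF assms(1) cop] using assms(2) by (auto simp: Vtilde_def)
  then have "qpoly N P a b \<in> V w"
    unfolding qpoly_def by (intro V_subst_XY V_varX V_varX_minus_varY)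
  from ev_V[OF this, of x y] show ?thesis
    using coset_of_eq[OF assms(1), of a "b - a"] assms(3)
    by (simp add: qcoeff_def qpoly_def ev_subst_XY val_def)
qed

lemma qcoeff_cong:
  assumes "same N a b a' b'"
  shows "qcoeff N P r s a b = qcoeff N P r s a' b'"
proof -
  have "[- a + b = - a' + b'] (mod int N)"
    using assms by (intro cong_add) (auto simp: same_def cong_minus_minus_iff)
  then have "coset_of N a (- a + b) = coset_of N a' (- a' + b')"
    using assms coset_of_mod[of N a "- a + b"] coset_of_mod[of N a' "- a' + b'"]
    by (simp add: same_def cong_def)
  then show ?thesis by (simp add: qcoeff_def qpoly_def)
qed

lemma q_od_cong: "same N a b a' b' \<Longrightarrow> q_od N P r s a b = q_od N P r s a' b'"
  using qcoeff_cong[of N a b a' b' P r s] qcoeff_cong[of N "- a" b "- a'" b' P r s]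
  by (simp add: q_od_def same_def cong_minus_minus_iff)

lemma q_ev_cong: "same N a b a' b' \<Longrightarrow> q_ev N P r s a b = q_ev N P r s a' b'"
  using qcoeff_cong[of N a b a' b' P r s] qcoeff_cong[of N "- a" b "- a'" b' P r s]
  by (simp add: q_ev_def same_def cong_minus_minus_iff)

text \<open>The family \<open>Q\<close> of the overview: on A(N) it is the generating function of
  \<open>qcoeff\<close>, by \<open>hpoly_qcoeff\<close>.\<close>

definition qfun :: "nat \<Rightarrow> ((int^2^2) set \<Rightarrow> rat poly poly) \<Rightarrow> int \<Rightarrow> int \<Rightarrow> rat \<Rightarrow> rat \<Rightarrow> rat" where
  "qfun N P a b x y = val N P a (b - a) (x - y) x"

lemma hpoly_q_od:
  assumes "N \<ge> 1" "P \<in> Vtilde (Gamma1 N) w" "cop N a b"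
  shows "hpoly (w + 2) (\<lambda>r s. q_od N P r s a b) x y = (qfun N P a b x y + qfun N P (- a) b (- x) y) / 2"
  unfolding q_od_def hpoly_scale hpoly_diff hpoly_uminus_left
  by (subst (1 2) hpoly_qcoeff[OF assms(1,2)]) (use assms(3) in \<open>simp_all add: qfun_def\<close>)

lemma hpoly_q_ev:
  assumes "N \<ge> 1" "P \<in> Vtilde (Gamma1 N) w" "cop N a b"
  shows "hpoly (w + 2) (\<lambda>r s. q_ev N P r s a b) x y = (qfun N P a b x y - qfun N P (- a) b (- x) y) / 2"
  unfolding q_ev_def hpoly_scale hpoly_add hpoly_uminus_left
  by (subst (1 2) hpoly_qcoeff[OF assms(1,2)]) (use assms(3) in \<open>simp_all add: qfun_def\<close>)

text \<open>The relation for \<open>S\<close>, combined with \<epsilon>, becomes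
  \<open>Q|T = - Q|\<delta>\<close>. The relation for \<open>U\<close>, with one term rewritten by
  \<open>S\<close>, becomes \<open>Q|\<sigma>T = Q|\<sigma> - Q\<close>; taken at both signs of the
  first coordinate it gives the symmetry of the even part.\<close>

lemma Wbar_plus_qfun:
  assumes N: "N \<ge> 1" and P: "P \<in> Wbar_plus (Gamma1 N) w" and ab: "cop N a b"
  shows qfun_J: "qfun N P (- a) (- b) (- x) (- y) = qfun N P a b x y"
    and qfun_homog: "qfun N P a b (- x) (- y) = (-1) ^ w * qfun N P a b x y"
    and qfun_T: "qfun N P (a + b) b (x + y) y = - qfun N P (- a) b (- x) y"
    and qfun_T_swap: "qfun N P b (a + b) y (x + y) = qfun N P b a y x - qfun N P a b x y"
    and qfun_ev_swap: "qfun N P a b x y - qfun N P (- a) b (- x) y =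
        qfun N P b a y x - qfun N P (- b) a (- y) x"
proof -
  note W = P[unfolded Wbar_plus_iff[OF N], THEN conjunct2, rule_format]
  have Vt: "P \<in> Vtilde (Gamma1 N) w" using P by (simp add: Wbar_plus_iff[OF N])
  have hom: "val N P c d (- x) (- y) = (-1) ^ w * val N P c d x y" if "cop N c d" for c d x y
    by (rule homog_uminus[OF val_Vtilde[OF N Vt that]])
  have J: "val N P (- c) (- d) x y = val N P c d (- x) (- y)" if "cop N c d" for c d x y
    using W[OF that, of "- x" "- y"] by simp
  \<comment> \<open>Homogeneity trades \<open>(-1) ^ w\<close> for a sign of the variables, so that
    \<epsilon> acts by the same formula for both parities.\<close>
  have eps: "val N P (- c) d x y = val N P c d x (- y)" if "cop N c d" for c d x y
    using W[OF that, of "- x" y] hom[OF that, of x "- y"] by (simp flip: power_mult_distrib mult.assoc)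
  have eps': "val N P c (- d) x y = val N P c d (- x) y" if "cop N c d" for c d x y
    using J[of "- c" d x y] eps[of c d "- x" "- y"] that by simp
  have S: "val N P c d x y = - val N P d c (- y) (- x)" if "cop N c d" for c d x y
    using W[OF that, of x y] eps[of d c "- y" x] that by (simp add: cop_commute add_eq_0_iff)
  \<comment> \<open>The three-term relation at the pair \<open>(a, - b)\<close>: one term is a value
    of \<open>Q\<close> by definition, another is the negative of one by \<open>S\<close>.\<close>
  have U: "qfun N P a b x y = qfun N P b a y x + val N P a (- b) y x" if "cop N a b" for a b x y
  proof -
    have "val N P (b - a) a (- x) (y - x) = - qfun N P a b x y"
      using S[of a "b - a" "x - y" x] that by (simp add: qfun_def)
    moreover have "val N P a (- b) y x + val N P b (a - b) (y - x) y + val N P (b - a) a (- x) (y - x) = 0"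
      using W[of a "- b" y x] that by (simp add: algebra_simps)
    ultimately show ?thesis by (simp add: qfun_def)
  qed
  show J': "qfun N P (- a) (- b) (- x) (- y) = qfun N P a b x y" for x y
    using J[of a "b - a" "- x - - y" "- x"] ab by (simp add: qfun_def algebra_simps)
  show "qfun N P a b (- x) (- y) = (-1) ^ w * qfun N P a b x y"
    using hom[of a "b - a" "x - y" x] ab by (simp add: qfun_def)
  show "qfun N P (a + b) b (x + y) y = - qfun N P (- a) b (- x) y"
    using S[of "- a" "b + a" "- x - y" "- x"] ab
    by (simp add: qfun_def add.commute)
  show "qfun N P b (a + b) y (x + y) = qfun N P b a y x - qfun N P a b x y"
    using U[of b a y x] eps'[of b a x y] ab by (simp add: qfun_def cop_commute)
  \<comment> \<open>In the difference of \<open>U\<close> at the two signs of the first coordinate,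
    the remaining \<open>val\<close> terms agree by \<epsilon> and \<open>J\<close> and
    cancel.\<close>
  show "qfun N P a b x y - qfun N P (- a) b (- x) y = qfun N P b a y x - qfun N P (- b) a (- y) x"
    using U[OF ab, of x y] U[of "- a" b "- x" y] eps'[of a b y x] J[OF ab, of y "- x"] ab
      J[of b "- a - b" "- y - x" "- y"]
    by (simp add: qfun_def cop_commute algebra_simps)
qed

section \<open>Constructing a period polynomial\<close>

text \<open>For \<open>Q = H|(\<alpha> - 1)\<close> the odd part is
  \<open>(H|T - H + H|\<alpha> - H|\<delta>)/2\<close>. This is the average of \<open>C\<close> and
  \<open>C|\<delta>\<close>, in which the even \<open>E\<close> drops out, hence \<open>C\<close>
  itself. The symmetry of \<open>E\<close> yields the relations for \<epsilon> and \<open>S\<close>;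
  the one for \<open>U\<close> needs only the symmetries of \<open>H\<close>.\<close>

lemma period_from_symmetric:
  fixes H C E :: "int \<Rightarrow> int \<Rightarrow> rat \<Rightarrow> rat \<Rightarrow> rat"
  assumes N: "N \<ge> 1"
    and hom: "\<And>a b. homog w (H a b)"
    and per: "\<And>a b a' b'. same N a b a' b' \<Longrightarrow> H a b = H a' b'"
    and J: "\<And>a b x y. H (- a) (- b) (- x) (- y) = H a b x y"
    and swap: "\<And>a b x y. H b a y x = H a b x y"
    and C: "\<And>a b x y. C a b x y = H (a + b) b (x + y) y - H a b x y + E a b x y"
    and C_od: "\<And>a b x y. C (- a) b (- x) y = C a b x y"
    and E_ev: "\<And>a b x y. E (- a) b (- x) y = - E a b x y"
    and E_swap: "\<And>a b x y. E b a y x = E a b x y"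
  obtains P where "P \<in> Wbar_plus (Gamma1 N) w"
    "\<And>a b x y. cop N a b \<Longrightarrow> (qfun N P a b x y + qfun N P (- a) b (- x) y) / 2 = C a b x y"
proof -
  \<comment> \<open>\<open>\<plusminus>(Q|\<sigma> - Q)\<close> for \<open>Q = H|(\<alpha> - 1)\<close>, in the coordinates \<open>v = (d, -c)\<close> that turn the action on cosets
    into the action on vectors\<close>
  define F where "F c d x y = (-1) ^ w * (H (c + d) d (x - y) x - H (c + d) c (x - y) (- y))" for c d x y
  have homF: "homog w (F c d)" for c d
  proof -
    have "homog w (\<lambda>x y. H (c + d) d (1 * x + (-1) * y) (1 * x + 0 * y))"
      "homog w (\<lambda>x y. H (c + d) c (1 * x + (-1) * y) (0 * x + (-1) * y))"
      by (rule homog_linear[OF hom])+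
    from homog_scale[OF homog_diff[OF this], of "(-1) ^ w"] show ?thesis by (simp add: F_def[abs_def])
  qed
  have perF: "F c d = F c' d'" if "same N c d c' d'" for c d c' d'
  proof -
    have "same N (c + d) d (c' + d') d'" "same N (c + d) c (c' + d') c'"
      using that by (auto simp: same_def intro: cong_add)
    from this[THEN per] show ?thesis by (intro ext) (simp add: F_def)
  qed
  obtain P where P: "P \<in> Vtilde (Gamma1 N) w" "\<And>c d. cop N c d \<Longrightarrow> val N P c d = F c d"
    using Vtilde_exists[of N w F, OF N homF perF] by blast
  \<comment> \<open>Symmetry of \<open>H|(\<alpha> - T)\<close> under \<sigma>: as \<open>C\<close>
    is odd and \<open>E\<close> even, it equals \<open>2E - H + H|\<delta>\<close>, and each of
    these terms is symmetric, the last one by \<open>swap\<close> and \<open>J\<close>.\<close>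
  have key: "H (b - a) b (y - x) y - H (a + b) b (x + y) y = H (a - b) a (x - y) x - H (a + b) a (x + y) x"
    for a b x y
  proof -
    have E2: "2 * E a b x y = H a b x y - H (- a) b (- x) y - H (a + b) b (x + y) y + H (b - a) b (y - x) y"
      for a b x y
      using C[of a b x y] C[of "- a" b "- x" y] C_od[of a b x y] E_ev[of a b x y] by (simp add: algebra_simps)
    show ?thesis
      using E2[of a b x y] E2[of b a y x] E_swap[of a b x y] swap[of a b x y] swap[of a "- b" x "- y"]
        J[of "- a" b "- x" y] by (simp add: algebra_simps)
  qed
  have homF': "F c d (- x) (- y) = (-1) ^ w * F c d x y" for c d x y by (rule homog_uminus[OF homF])
  have FJ: "F (- c) (- d) (- x) (- y) = F c d x y" for c d x y
    unfolding F_def using J[of "c + d" d "x - y" x] J[of "c + d" c "x - y" "- y"] by (simp add: algebra_simps)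
  have Feps: "F (- c) d (- x) y = (-1) ^ w * F c d x y" for c d x y
  proof -
    have "H (- c + d) d (- x - y) (- x) - H (- c + d) (- c) (- x - y) (- y) =
        H (c + d) d (- x - - y) (- x) - H (c + d) c (- x - - y) (- (- y))"
      using key[of d c "- x" y] J[of "c - d" c "x + y" y] by (simp add: algebra_simps)
    then have "F (- c) d (- x) y = F c d (- x) (- y)" by (simp only: F_def)
    then show ?thesis by (simp add: homF')
  qed
  have FS: "F c d x y + F (- d) c (- y) x = 0" for c d x y
  proof -
    have "- (x + y) = - y - x" by simp
    from J[of "d - c" d "x + y" x, unfolded this]
    have "H (c + d) d (x - y) x - H (c + d) c (x - y) (- y) =
        - (H (- d + c) c (- y - x) (- y) - H (- d + c) (- d) (- y - x) (- x))"
      using key[of d c x "- y"] by (simp add: algebra_simps)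
    then show ?thesis by (simp add: F_def right_diff_distrib)
  qed
  \<comment> \<open>After expansion the six terms cancel in pairs by \<open>swap\<close> and
    \<open>J\<close>.\<close>
  have FU: "F c d x y + F (- d) (c + d) (x - y) x + F (- c - d) c (- y) (x - y) = 0" for c d x y
    unfolding F_def
    using swap[of c "c + d" "- y" "x - y"] swap[of c "- d" "- y" "- x"] J[of d "c + d" x "x - y"]
      swap[of d "c + d" x "x - y"]
    by (simp add: algebra_simps)
  have "P \<in> Wbar_plus (Gamma1 N) w"
  proof (subst Wbar_plus_iff[OF N], intro conjI P(1) allI impI)
    fix c d x y assume cd: "cop N c d"
    have c1: "cop N (- d) c" "cop N (- c) d" "cop N (- c) (- d)"
      using cd cop_commute[of N c d] by simp_all
    have c2: "cop N (- d) (c + d)"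
      using cd cop_commute[of N "c + d" d] by simp
    have c3: "cop N (- c - d) c"
      using cd cop_commute[of N "c + d" c] cop_uminus(1)[of N "c + d" c] by simp
    note v = c1[THEN P(2)] c2[THEN P(2)] c3[THEN P(2)] P(2)[OF cd]
    show "val N P (- c) (- d) (- x) (- y) = val N P c d x y"
      "val N P (- c) d (- x) y = (- 1) ^ w * val N P c d x y"
      "val N P c d x y + val N P (- d) c (- y) x = 0"
      "val N P c d x y + val N P (- d) (c + d) (x - y) x + val N P (- c - d) c (- y) (x - y) = 0"
      unfolding v by (rule FJ Feps FS FU)+
  qed
  moreover have "(qfun N P a b x y + qfun N P (- a) b (- x) y) / 2 = C a b x y" if "cop N a b" for a b x y
  proof -
    \<comment> \<open>The arguments of \<open>qfun\<close> undo the change of coordinates in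
      \<open>F\<close>, and the sign \<open>(-1) ^ w\<close> in \<open>F\<close> absorbs the one
      from homogeneity.\<close>
    have q: "qfun N P a b x y = H (b - a) b (y - x) y - H a b x y" if "cop N a b" for a b x y
    proof -
      have "qfun N P a b x y = (-1) ^ w * F a (b - a) (y - x) (- x)"
        using P(2)[of a "b - a"] that homF'[of a "b - a" "y - x" "- x"]
        by (simp add: qfun_def flip: mult.assoc power_mult_distrib)
      also have "\<dots> = H b (b - a) y (y - x) - H b a y x"
        by (simp add: F_def flip: mult.assoc power_mult_distrib)
      finally show ?thesis using swap[of "b - a" b "y - x" y] swap[of a b x y] by simp
    qed
    show ?thesis
      using q[of a b x y] q[of "- a" b "- x" y] that C[of a b x y] C[of "- a" b "- x" y] C_od[of a b x y] E_ev[of a b x y]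
      by (simp add: algebra_simps)
  qed
  ultimately show thesis using that by blast
qed

section \<open>Linear combinations of generators\<close>

text \<open>The family \<open>G\<close> is a parameter so that the same coefficients can be applied
  to generators, to relators and to even generators.\<close>

definition comb :: "nat \<Rightarrow> nat \<Rightarrow> (nat \<Rightarrow> nat \<Rightarrow> int \<Rightarrow> int \<Rightarrow> (dz_gen \<Rightarrow>\<^sub>0 rat)) \<Rightarrow>
    (nat \<Rightarrow> nat \<Rightarrow> int \<Rightarrow> int \<Rightarrow> rat) \<Rightarrow> (dz_gen \<Rightarrow>\<^sub>0 rat)" where
  "comb k N G h = (\<Sum>(r, s)\<in>rs_pairs k. \<Sum>(a, b)\<in>pairsA N. dz_scale (h r s a b) (G r s a b))"

lemma zpart_comb: "zpart k N (comb k N G h) c d X Y =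
    (\<Sum>(r, s)\<in>rs_pairs k. \<Sum>(a, b)\<in>pairsA N. h r s a b * zpart k N (G r s a b) c d X Y)"
  by (simp add: comb_def zpart_sum zpart_linear case_prod_unfold)

lemma ppart_comb: "ppart k N (comb k N G h) c d X Y =
    (\<Sum>(r, s)\<in>rs_pairs k. \<Sum>(a, b)\<in>pairsA N. h r s a b * ppart k N (G r s a b) c d X Y)"
  by (simp add: comb_def ppart_sum ppart_linear case_prod_unfold)

lemma lk_comb: "lk (comb k N G h) g =
    (\<Sum>(r, s)\<in>rs_pairs k. \<Sum>(a, b)\<in>pairsA N. h r s a b * lk (G r s a b) g)"
  by (simp add: comb_def lookup_sum case_prod_unfold)

lemma comb_scale: "comb k N G (\<lambda>r s a b. c * h r s a b) = dz_scale c (comb k N G h)"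
  by (rule poly_mapping_eqI) (simp add: lk_comb sum_distrib_left case_prod_unfold mult.assoc)

lemma comb_diff: "comb k N G (\<lambda>r s a b. f r s a b - g r s a b) = comb k N G f - comb k N G g"
  by (rule poly_mapping_eqI) (simp add: lk_comb lookup_minus sum_subtractf case_prod_unfold left_diff_distrib)

lemma comb_mem_subspace:
  assumes "dz.subspace S"
    and "\<And>r s a b. (r, s) \<in> rs_pairs k \<Longrightarrow> (a, b) \<in> pairsA N \<Longrightarrow> G r s a b \<in> S"
  shows "comb k N G h \<in> S"
  unfolding comb_def case_prod_unfold
  by (intro dz.subspace_sum[OF assms(1)] dz.subspace_scale[OF assms(1)] assms(2)) auto

lemma sum_pairsA_same:
  assumes "N \<ge> 1"
  shows "(\<Sum>(a, b)\<in>pairsA N. h a b * (if same N a b c d then v else 0)) =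
    (if cop N c d then h (c mod int N) (d mod int N) * v else (0::rat))"
proof -
  have "(\<Sum>(a, b)\<in>pairsA N. h a b * (if same N a b c d then v else 0)) =
      (\<Sum>p\<in>pairsA N. if p = (c mod int N, d mod int N) then h (c mod int N) (d mod int N) * v else 0)"
  proof (intro sum.cong refl)
    fix p assume "p \<in> pairsA N"
    then obtain a b where "p = (a, b)" "a mod int N = a" "b mod int N = b"
      using pairsA_mod by (cases p) blast
    then show "(case p of (a, b) \<Rightarrow> h a b * (if same N a b c d then v else 0)) =
        (if p = (c mod int N, d mod int N) then h (c mod int N) (d mod int N) * v else 0)"
      by (auto simp: same_def cong_def)
  qed
  then show ?thesis using mod_pairsA[OF assms] by (simp add: sum.delta)
qed

lemma zpart_comb_Zd:
  assumes "N \<ge> 1"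
  shows "zpart k N (comb k N (Zd N) h) c d X Y =
    (if cop N c d then hpoly k (\<lambda>r s. h r s (c mod int N) (d mod int N)) X Y else 0)"
proof -
  have "zpart k N (comb k N (Zd N) h) c d X Y =
    (\<Sum>(r, s)\<in>rs_pairs k. \<Sum>(a, b)\<in>pairsA N. h r s a b * (if same N a b c d then divmon r s X Y else 0))"
    unfolding zpart_comb by (intro sum.cong refl) (auto simp: zpart_Zd intro!: sum.cong)
  then show ?thesis unfolding sum_pairsA_same[OF assms] by (simp add: hpoly_def case_prod_unfold)
qed

lemma ppart_comb_Pd:
  assumes "N \<ge> 1"
  shows "ppart k N (comb k N (Pd N) h) c d X Y =
    (if cop N c d then hpoly k (\<lambda>r s. h r s (c mod int N) (d mod int N)) X Y else 0)"
proof -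
  have "ppart k N (comb k N (Pd N) h) c d X Y =
    (\<Sum>(r, s)\<in>rs_pairs k. \<Sum>(a, b)\<in>pairsA N. h r s a b * (if same N a b c d then divmon r s X Y else 0))"
    unfolding ppart_comb by (intro sum.cong refl) (auto simp: ppart_Pd intro!: sum.cong)
  then show ?thesis unfolding sum_pairsA_same[OF assms] by (simp add: hpoly_def case_prod_unfold)
qed

definition Zsum :: "nat \<Rightarrow> nat \<Rightarrow> nat \<Rightarrow> int \<Rightarrow> int \<Rightarrow> (dz_gen \<Rightarrow>\<^sub>0 rat)" where
  "Zsum N r s a b = Zs N (r + s) (a + b)"

lemma Zsum_parts [simp]:
  "zpart k N (comb k N (Zsum N) h) c d X Y = 0" "ppart k N (comb k N (Zsum N) h) c d X Y = 0"
  "ppart k N (comb k N (Zd N) h) c d X Y = 0" "zpart k N (comb k N (Pd N) h) c d X Y = 0"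
  "lk (comb k N (Zd N) h) (GenZs j t) = 0" "lk (comb k N (Pd N) h) (GenZs j t) = 0"
  by (simp_all add: zpart_comb ppart_comb lk_comb Zsum_def)

lemma comb_free:
  assumes "N \<ge> 1"
  shows "comb k N (Zd N) h \<in> dz_free k N" "comb k N (Pd N) h \<in> dz_free k N"
    "comb k N (Zsum N) h \<in> dz_free k N" "comb k N (shrel N) h \<in> dz_free k N"
    "comb k N (strel N) h \<in> dz_free k N" "comb k N (evgen N) h \<in> dz_free k N"
  using assms
  by (auto intro!: comb_mem_subspace[OF subspace_dz_free] Zd_free Pd_free Zs_free shrel_free strel_free evgen_free
      simp: pairsA_iff Zsum_def rs_pairs_def)

lemma comb_shrel_parts:
  shows "ppart k N (comb k N (shrel N) h) c d X Y = ppart k N (comb k N (Pd N) h) c d X Y"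
    "zpart k N (comb k N (shrel N) h) c d X Y =
      - (ppart k N (comb k N (Pd N) h) (c + d) d (X + Y) Y + ppart k N (comb k N (Pd N) h) d (c + d) Y (X + Y))"
    "lk (comb k N (shrel N) h) (GenZs j t) = 0"
proof -
  show P: "ppart k N (comb k N (shrel N) h) c d X Y = ppart k N (comb k N (Pd N) h) c d X Y" for c d X Y
    by (simp add: ppart_comb shrel_def ppart_linear ppart_sum)
  have "comb k N (shrel N) h \<in> dz.span (shrels k N)"
    by (rule comb_mem_subspace[OF dz.subspace_span]) (auto simp: shrels_def intro!: dz.span_base)
  from zpart_span_shrels[OF this] show "zpart k N (comb k N (shrel N) h) c d X Y =
      - (ppart k N (comb k N (Pd N) h) (c + d) d (X + Y) Y + ppart k N (comb k N (Pd N) h) d (c + d) Y (X + Y))"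
    by (simp add: P)
  show "lk (comb k N (shrel N) h) (GenZs j t) = 0"
    by (simp add: lk_comb shrel_def lookup_minus lookup_add lookup_sum)
qed

lemma comb_strel_parts:
  shows "ppart k N (comb k N (strel N) h) c d X Y = ppart k N (comb k N (Pd N) h) c d X Y"
    "zpart k N (comb k N (strel N) h) c d X Y =
      - (ppart k N (comb k N (Pd N) h) c d X Y + ppart k N (comb k N (Pd N) h) d c Y X)"
    "lk (comb k N (strel N) h) (GenZs j t) = - lk (comb k N (Zsum N) h) (GenZs j t)"
proof -
  show P: "ppart k N (comb k N (strel N) h) c d X Y = ppart k N (comb k N (Pd N) h) c d X Y" for c d X Y
    by (simp add: ppart_comb strel_def ppart_linear)
  have "comb k N (strel N) h \<in> dz.span (strels k N)"
    by (rule comb_mem_subspace[OF dz.subspace_span]) (auto simp: strels_def intro!: dz.span_base)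
  from zpart_span_strels[OF this] show "zpart k N (comb k N (strel N) h) c d X Y =
      - (ppart k N (comb k N (Pd N) h) c d X Y + ppart k N (comb k N (Pd N) h) d c Y X)"
    by (simp add: P)
  show "lk (comb k N (strel N) h) (GenZs j t) = - lk (comb k N (Zsum N) h) (GenZs j t)"
    by (simp add: lk_comb strel_def Zsum_def lookup_minus lookup_add case_prod_unfold sum_negf)
qed

lemma comb_evgen_ppart:
  "ppart k N (comb k N (evgen N) h) c d X Y =
     ppart k N (comb k N (Pd N) h) c d X Y - ppart k N (comb k N (Pd N) h) (- c) d (- X) Y
     - ppart k N (comb k N (Pd N) h) c (- d) X (- Y) + ppart k N (comb k N (Pd N) h) (- c) (- d) (- X) (- Y)"
proof -
  have "ppart k N (comb k N (evgen N) h) c d X Y = (\<Sum>(r, s)\<in>rs_pairs k. \<Sum>(a, b)\<in>pairsA N. h r s a b *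
    (ppart k N (Pd N r s a b) c d X Y - ppart k N (Pd N r s a b) (- c) d (- X) Y
     - ppart k N (Pd N r s a b) c (- d) X (- Y) + ppart k N (Pd N r s a b) (- c) (- d) (- X) (- Y)))"
    unfolding ppart_comb by (intro sum.cong refl) (auto simp: evgen_parts intro!: sum.cong)
  then show ?thesis
    by (simp add: ppart_comb case_prod_unfold sum_subtractf sum.distrib right_diff_distrib distrib_left)
qed

text \<open>Reindexing by negation of both indices, with the parity of \<open>h\<close>, replaces
  each single zeta at \<open>c\<close> by \<open>(-1) ^ k\<close> times the one at
  \<open>- c\<close>. Adding both forms gives twice the sum as a combination of even
  generators.\<close>

lemma comb_Zsum_even:
  assumes N: "N \<ge> 1"
    and h: "\<And>r s a b. (r, s) \<in> rs_pairs k \<Longrightarrow> (a, b) \<in> pairsA N \<Longrightarrow>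
      h r s ((- a) mod int N) ((- b) mod int N) = (-1) ^ k * h r s a b"
  shows "comb k N (Zsum N) h \<in> dz.span (evgens k N)"
proof -
  let ?A = "\<lambda>r s a b. dz_scale ((-1) ^ k) (Zs N k (- (a + b)))"
  let ?B = "\<lambda>r s a b. Zs N k (a + b) + dz_scale ((-1) ^ k) (Zs N k (- (a + b)))"
  have Zs_mod: "Zs N k (c mod int N) = Zs N k c" "Zs N k (- (c mod int N)) = Zs N k (- c)" for c
    by (simp_all add: Zs_def mod_minus_eq)
  have A: "comb k N ?A h = comb k N (Zsum N) h"
    unfolding comb_def case_prod_unfold
  proof (rule sum.cong[OF refl])
    fix p assume p: "p \<in> rs_pairs k"
    obtain r s where rs: "p = (r, s)" by (cases p)
    have k: "r + s = k" using p rs by (auto simp: rs_pairs_def)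
    let ?i = "\<lambda>(a, b). ((- a) mod int N, (- b) mod int N)"
    show "(\<Sum>q\<in>pairsA N. dz_scale (h (fst p) (snd p) (fst q) (snd q)) (dz_scale ((- 1) ^ k) (Zs N k (- (fst q + snd q))))) =
        (\<Sum>q\<in>pairsA N. dz_scale (h (fst p) (snd p) (fst q) (snd q)) (Zsum N (fst p) (snd p) (fst q) (snd q)))"
    proof (rule sum.reindex_bij_witness[of _ ?i ?i])
      fix q assume q: "q \<in> pairsA N"
      obtain a b where ab: "q = (a, b)" by (cases q)
      note m = pairsA_mod[OF q[unfolded ab]]
      show "?i (?i q) = q" using m by (simp add: ab mod_minus_eq)
      show "?i q \<in> pairsA N" using m by (simp add: ab mod_pairsA[OF N])
      have "Zs N k ((- a) mod int N + (- b) mod int N) = Zs N k (- (a + b))"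
        by (simp add: Zs_def mod_add_eq)
      then show "dz_scale (h (fst p) (snd p) (fst (?i q)) (snd (?i q))) (Zsum N (fst p) (snd p) (fst (?i q)) (snd (?i q))) =
          dz_scale (h (fst p) (snd p) (fst q) (snd q)) (dz_scale ((- 1) ^ k) (Zs N k (- (fst q + snd q))))"
        using h[of r s a b] p q by (simp add: rs ab Zsum_def k mult.commute)
      show "?i (?i q) = q" using m by (simp add: ab mod_minus_eq)
      show "?i q \<in> pairsA N" using m by (simp add: ab mod_pairsA[OF N])
    qed
  qed
  have B: "comb k N ?B h \<in> dz.span (evgens k N)"
  proof (rule comb_mem_subspace[OF dz.subspace_span])
    fix a b
    have "Zs N k ((a + b) mod int N) + dz_scale ((-1) ^ k) (Zs N k (- ((a + b) mod int N))) \<in> evgens k N"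
      using N by (auto simp: evgens_def intro!: exI[of _ "(a + b) mod int N"])
    then show "?B r s a b \<in> dz.span (evgens k N)" for r s :: nat
      unfolding Zs_mod by (rule dz.span_base)
  qed
  have "comb k N ?B h = comb k N (Zsum N) h + comb k N ?A h"
    by (rule poly_mapping_eqI, unfold lookup_add lk_comb case_prod_unfold sum.distrib[symmetric])
       (intro sum.cong refl, auto simp: Zsum_def rs_pairs_def lookup_add algebra_simps)
  also have "\<dots> = dz_scale 2 (comb k N (Zsum N) h)"
    unfolding A by (rule poly_mapping_eqI) (simp add: lookup_add)
  finally have "comb k N (Zsum N) h = dz_scale (1/2) (comb k N ?B h)"
    by simp
  then show ?thesis using dz.span_scale[OF B, of "1/2"] by simp
qed

text \<open>For an even family the four summands of \<open>evgen\<close> contribute equally, so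
  applying the coefficients to \<open>evgen\<close> gives 4 times the combination.\<close>

lemma comb_Pd_even:
  assumes N: "N \<ge> 1"
    and h1: "\<And>c d X Y. ppart k N (comb k N (Pd N) h) (- c) d (- X) Y = - ppart k N (comb k N (Pd N) h) c d X Y"
    and h2: "\<And>c d X Y. ppart k N (comb k N (Pd N) h) c (- d) X (- Y) = - ppart k N (comb k N (Pd N) h) c d X Y"
  shows "comb k N (Pd N) h \<in> dz.span (evgens k N)"
proof -
  have "comb k N (evgen N) h = dz_scale 4 (comb k N (Pd N) h)"
  proof (rule dz_eqI)
    show "dz_scale 4 (comb k N (Pd N) h) \<in> dz_free k N"
      by (intro dz.subspace_scale[OF subspace_dz_free] comb_free N)
    show "zpart k N (comb k N (evgen N) h) a b X Y = zpart k N (dz_scale 4 (comb k N (Pd N) h)) a b X Y" for a b X Y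
      unfolding zpart_linear by (simp add: zpart_comb evgen_parts case_prod_unfold)
    show "ppart k N (comb k N (evgen N) h) a b X Y = ppart k N (dz_scale 4 (comb k N (Pd N) h)) a b X Y" for a b X Y
      unfolding ppart_linear comb_evgen_ppart by (simp add: h1 h2)
    show "lk (comb k N (evgen N) h) (GenZs k c) = lk (dz_scale 4 (comb k N (Pd N) h)) (GenZs k c)" for c
      by (simp add: lk_comb[of k N "evgen N"] evgen_parts case_prod_unfold)
  qed (rule comb_free[OF N])
  moreover have "comb k N (evgen N) h \<in> dz.span (evgens k N)"
    by (rule comb_mem_subspace[OF dz.subspace_span]) (auto simp: evgens_def intro!: dz.span_base)
  ultimately have "dz_scale (1/4) (dz_scale 4 (comb k N (Pd N) h)) \<in> dz.span (evgens k N)"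
    using dz.span_scale by metis
  then show ?thesis by simp
qed

section \<open>Period polynomials and relations\<close>

text \<open>Negating \<open>a\<close> only exchanges the two summands in the definitions. Negating
  \<open>b\<close> reduces to this by the first relation, which comes from \<open>J\<close> and
  homogeneity, because \<open>w\<close> and \<open>r + s\<close> have equal parity.\<close>

lemma q_parity:
  assumes N: "N \<ge> 1" and P: "P \<in> Wbar_plus (Gamma1 N) w"
    and rs: "(r, s) \<in> rs_pairs (w + 2)" and ab: "cop N a b"
  shows "qcoeff N P r s (- a) (- b) = (-1) ^ w * qcoeff N P r s a b"
    and "q_od N P r s a b = (-1) ^ (r + 1) * q_od N P r s (- a) b"
    and "q_od N P r s a b = (-1) ^ (s + 1) * q_od N P r s a (- b)"
    and "q_ev N P r s a b = (-1) ^ r * q_ev N P r s (- a) b"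
    and "q_ev N P r s a b = (-1) ^ s * q_ev N P r s a (- b)"
    and "q_ev N P r s a b = q_ev N P s r b a"
proof -
  have Vt: "P \<in> Vtilde (Gamma1 N) w" using P by (simp add: Wbar_plus_iff[OF N])
  note hq = hpoly_qcoeff[OF N Vt, folded qfun_def]
  note Q = Wbar_plus_qfun[OF N P]
  have J: "qcoeff N P r s (- a) (- b) = (-1) ^ w * qcoeff N P r s a b" if "cop N a b" for a b
  proof (rule hpoly_eqD[OF _ rs])
    fix x y
    show "hpoly (w + 2) (\<lambda>r s. qcoeff N P r s (- a) (- b)) x y =
        hpoly (w + 2) (\<lambda>r s. (-1) ^ w * qcoeff N P r s a b) x y"
      unfolding hpoly_scale using Q(1)[OF that, of "- x" "- y"] Q(2)[OF that, of x y] that by (simp add: hq del: add_2_eq_Suc')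
  qed
  show "qcoeff N P r s (- a) (- b) = (-1) ^ w * qcoeff N P r s a b" by (rule J[OF ab])
  have J2: "qcoeff N P r s a (- b) = (-1) ^ w * qcoeff N P r s (- a) b"
    using J[of "- a" b] ab by simp
  have w: "(-1 :: rat) ^ w = (-1) ^ r * (-1) ^ s"
    using rs by (auto simp: rs_pairs_def simp flip: power_add)
  show "q_od N P r s a b = (-1) ^ (r + 1) * q_od N P r s (- a) b"
    "q_ev N P r s a b = (-1) ^ r * q_ev N P r s (- a) b"
    by (cases "even r"; simp add: q_od_def q_ev_def)+
  show "q_od N P r s a b = (-1) ^ (s + 1) * q_od N P r s a (- b)"
    "q_ev N P r s a b = (-1) ^ s * q_ev N P r s a (- b)"
    using J[OF ab] J2 unfolding w
    by (cases "even r"; cases "even s"; simp add: q_od_def q_ev_def)+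
  have "hpoly (w + 2) (\<lambda>r s. q_ev N P r s a b) x y = hpoly (w + 2) (\<lambda>r s. q_ev N P s r b a) x y" for x y
    using Q(5)[OF ab, of x y] ab unfolding hpoly_swap[of _ "\<lambda>r s. q_ev N P r s b a"]
    by (simp add: hpoly_q_ev[OF N Vt] cop_commute[of N b a] del: add_2_eq_Suc')
  from hpoly_eqD[OF this rs] show "q_ev N P r s a b = q_ev N P s r b a" .
qed

lemma same_mod: "same N (a mod int N) (b mod int N) a b"
  by (simp add: same_def)

lemma Pd_parts_q:
  assumes N: "N \<ge> 1" and P: "P \<in> Vtilde (Gamma1 N) w"
  shows "ppart (w + 2) N (comb (w + 2) N (Pd N) (qcoeff N P)) c d X Y = (if cop N c d then qfun N P c d X Y else 0)"
    "ppart (w + 2) N (comb (w + 2) N (Pd N) (q_ev N P)) c d X Y =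
      (if cop N c d then (qfun N P c d X Y - qfun N P (- c) d (- X) Y) / 2 else 0)"
    "zpart (w + 2) N (comb (w + 2) N (Zd N) (q_ev N P)) c d X Y =
      (if cop N c d then (qfun N P c d X Y - qfun N P (- c) d (- X) Y) / 2 else 0)"
    "zpart (w + 2) N (comb (w + 2) N (Zd N) (q_od N P)) c d X Y =
      (if cop N c d then (qfun N P c d X Y + qfun N P (- c) d (- X) Y) / 2 else 0)"
  unfolding ppart_comb_Pd[OF N] zpart_comb_Zd[OF N]
    qcoeff_cong[OF same_mod] q_ev_cong[OF same_mod] q_od_cong[OF same_mod]
  by (simp_all add: hpoly_qcoeff[OF N P, folded qfun_def] hpoly_q_ev[OF N P] hpoly_q_od[OF N P] del: add_2_eq_Suc')

text \<open>The rules for \<open>Q|T\<close> and \<open>Q|\<sigma>T\<close> turn the Z-part of the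
  right side into \<open>2Q + Q|\<delta>\<close>. The P-parts cancel, and single zetas come from the
  stuffle relators alone.\<close>

lemma qcoeff_relation:
  assumes N: "N \<ge> 1" and P: "P \<in> Wbar_plus (Gamma1 N) w" and k: "k = w + 2"
  shows "dz_scale 3 (comb k N (Zd N) (q_od N P)) + comb k N (Zd N) (q_ev N P) + comb k N (Zsum N) (qcoeff N P) =
    comb k N (shrel N) (qcoeff N P) - comb k N (strel N) (qcoeff N P)" (is "?l = ?r")
proof (rule dz_eqI)
  have Vt: "P \<in> Vtilde (Gamma1 N) w" using P by (simp add: Wbar_plus_iff[OF N])
  note Q = Wbar_plus_qfun[OF N P]
  show "?l \<in> dz_free k N" "?r \<in> dz_free k N"
    by (intro dz.subspace_add[OF subspace_dz_free] dz.subspace_diff[OF subspace_dz_free]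
      dz.subspace_scale[OF subspace_dz_free] comb_free N)+
  show "ppart k N ?l a b X Y = ppart k N ?r a b X Y" for a b X Y
    unfolding ppart_linear by (simp add: comb_shrel_parts comb_strel_parts)
  show "lk ?l (GenZs k c) = lk ?r (GenZs k c)" for c
    by (simp add: lookup_add lookup_minus comb_shrel_parts comb_strel_parts)
  show "zpart k N ?l a b X Y = zpart k N ?r a b X Y" for a b X Y
  proof (cases "cop N a b")
    case False
    then show ?thesis unfolding zpart_linear
      by (simp add: comb_shrel_parts comb_strel_parts k Pd_parts_q[OF N Vt] cop_commute[of N b]
        del: add_2_eq_Suc')
  next
    case True
    then show ?thesis unfolding zpart_linear
      using Q(3)[OF True, of X Y] Q(4)[OF True, of Y X]
      by (simp add: add_divide_distrib diff_divide_distrib comb_shrel_parts comb_strel_parts k Pd_parts_q[OF N Vt] cop_commute[of N b]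
        del: add_2_eq_Suc')
  qed
qed

lemma shrels_strels_span:
  "comb k N (shrel N) h \<in> dz.span (dz_relators k N)" "comb k N (strel N) h \<in> dz.span (dz_relators k N)"
  by (rule comb_mem_subspace[OF dz.subspace_span];
      auto simp: dz_relators_eq shrels_def strels_def intro!: dz.span_base)+

text \<open>As the even part is symmetric, stuffle rewrites its combination of Z-generators as half
  of the same combination of P-generators minus single zetas, all of which lie in the even
  span.\<close>

lemma q_od_even_relation:
  assumes N: "N \<ge> 1" and P: "P \<in> Wbar_plus (Gamma1 N) w" and k: "k = w + 2"
  shows "\<exists>y\<in>dz.span (evgens k N).
    dz_scale 3 (comb k N (Zd N) (q_od N P)) - y \<in> dz.span (dz_relators k N)"
proof
  have Vt: "P \<in> Vtilde (Gamma1 N) w" using P by (simp add: Wbar_plus_iff[OF N])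
  note Q = Wbar_plus_qfun[OF N P]
  \<comment> \<open>The single zetas receive half of \<open>q_ev\<close> from stuffle and minus
    \<open>qcoeff\<close> from \<open>qcoeff_relation\<close>; \<open>y\<close> is the resulting
    even representative.\<close>
  define t where "t r s a b = 1/2 * q_ev N P r s a b - qcoeff N P r s a b" for r s a b
  define y where "y = comb k N (Zsum N) t - dz_scale (1/2) (comb k N (Pd N) (q_ev N P))"
  have t: "comb k N (Zsum N) t = dz_scale (1/2) (comb k N (Zsum N) (q_ev N P)) - comb k N (Zsum N) (qcoeff N P)"
    unfolding t_def[abs_def] comb_diff comb_scale ..
  have "comb k N (Pd N) (q_ev N P) \<in> dz.span (evgens k N)"
  proof (rule comb_Pd_even[OF N])
    have 1: "qfun N P (- c) (- d) x y = qfun N P c d (- x) (- y)" if "cop N c d" for c d x y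
      using Q(1)[OF that, of "- x" "- y"] by simp
    have 2: "qfun N P c (- d) x (- y) = qfun N P (- c) d (- x) y" if "cop N c d" for c d x y
      using 1[of "- c" d x "- y"] that by simp
    show "ppart k N (comb k N (Pd N) (q_ev N P)) (- c) d (- X) Y = - ppart k N (comb k N (Pd N) (q_ev N P)) c d X Y"
      "ppart k N (comb k N (Pd N) (q_ev N P)) c (- d) X (- Y) = - ppart k N (comb k N (Pd N) (q_ev N P)) c d X Y" for c d X Y
      unfolding k by (simp_all add: Pd_parts_q[OF N Vt] 1 2 diff_divide_distrib del: add_2_eq_Suc')
  qed
  moreover have "comb k N (Zsum N) t \<in> dz.span (evgens k N)"
  proof (rule comb_Zsum_even[OF N])
    fix r s a b assume rs: "(r, s) \<in> rs_pairs k" and ab: "(a, b) \<in> pairsA N"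
    then have cop: "cop N a b" by (simp add: pairsA_iff)
    have "t r s (- a) (- b) = (-1) ^ w * t r s a b"
      using q_parity(1)[OF N P rs[unfolded k] cop] q_parity(1)[OF N P rs[unfolded k], of "- a" b] cop
      by (simp add: t_def q_ev_def algebra_simps)
    then show "t r s ((- a) mod int N) ((- b) mod int N) = (-1) ^ k * t r s a b"
      by (simp add: t_def q_ev_cong[OF same_mod] qcoeff_cong[OF same_mod] k)
  qed
  ultimately show y: "y \<in> dz.span (evgens k N)"
    unfolding y_def by (intro dz.span_diff dz.span_scale)
  let ?X1 = "dz_scale 3 (comb k N (Zd N) (q_od N P))" and ?X2 = "comb k N (Zd N) (q_ev N P)"
    and ?X3 = "comb k N (Zsum N) (qcoeff N P)" and ?s = "dz_scale (- 1/2) (comb k N (strel N) (q_ev N P))"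
  have "?X2 + ?X3 + y = ?s"
  proof (rule dz_eqI)
    show "?X2 + ?X3 + y \<in> dz_free k N" "?s \<in> dz_free k N"
      using span_evgens_free[OF N] y
      by (auto intro!: dz.subspace_add[OF subspace_dz_free] dz.subspace_neg[OF subspace_dz_free]
        dz.subspace_scale[OF subspace_dz_free] comb_free N)
    show "ppart k N (?X2 + ?X3 + y) a b X Y = ppart k N ?s a b X Y" for a b X Y
      unfolding ppart_linear y_def by (simp add: comb_strel_parts)
    show "lk (?X2 + ?X3 + y) (GenZs k c) = lk ?s (GenZs k c)" for c
      by (simp add: y_def lookup_add lookup_minus comb_strel_parts t)
    show "zpart k N (?X2 + ?X3 + y) a b X Y = zpart k N ?s a b X Y" for a b X Y
      using Q(5)[of a b X Y] unfolding zpart_linear y_def k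
      by (simp add: comb_strel_parts Pd_parts_q[OF N Vt] cop_commute[of N b] diff_divide_distrib
          del: add_2_eq_Suc')
  qed
  moreover have "?X1 - y = (?X1 + ?X2 + ?X3) - (?X2 + ?X3 + y)" by simp
  ultimately have "?X1 - y = comb k N (shrel N) (qcoeff N P) - comb k N (strel N) (qcoeff N P) - ?s"
    using qcoeff_relation[OF N P k] by (simp only:)
  then show "?X1 - y \<in> dz.span (dz_relators k N)"
    by (simp only:) (intro dz.span_diff dz.span_scale shrels_strels_span)
qed

text \<open>The relation splits into a shuffle part \<open>u\<close> and a stuffle part
  \<open>v\<close>, whose P-parts together cancel that of \<open>y\<close>. Eliminating the P-part
  of \<open>u\<close> leaves the equation required by \<open>period_from_symmetric\<close>.\<close>

lemma period_of_relation:
  assumes N: "N \<ge> 1" and k: "k = w + 2"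
    and c: "\<And>r s a b. (r, s) \<in> rs_pairs k \<Longrightarrow> (a, b) \<in> pairsA N \<Longrightarrow>
      c r s a b = (-1) ^ (r + 1) * c r s ((- a) mod int N) b \<and>
      c r s a b = (-1) ^ (s + 1) * c r s a ((- b) mod int N)"
    and y: "y \<in> dz.span (evgens k N)" "comb k N (Zd N) c - y \<in> dz.span (dz_relators k N)"
  shows "\<exists>P\<in>Wbar_plus (Gamma1 N) w. \<forall>(r, s)\<in>rs_pairs k. \<forall>(a, b)\<in>pairsA N. c r s a b = q_od N P r s a b"
proof -
  have c1: "c r s a b = (-1) ^ (r + 1) * c r s ((- a) mod int N) b"
    and c2: "c r s a b = (-1) ^ (s + 1) * c r s a ((- b) mod int N)"
    if "(r, s) \<in> rs_pairs k" "(a, b) \<in> pairsA N" for r s a b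
    using c[OF that] by blast+
  obtain u v where uv: "comb k N (Zd N) c - y = u + v" "u \<in> dz.span (shrels k N)" "v \<in> dz.span (strels k N)"
    using y(2) unfolding dz_relators_eq dz.span_Un by auto
  define C where "C = zpart k N (comb k N (Zd N) c)"
  define e where "e = ppart k N y"
  define g where "g = ppart k N v"
  \<comment> \<open>The P-part of \<open>u\<close> is \<open>- (e + g)\<close>, so its Z-part is
    \<open>G|T\<close> with \<open>G = (g + e)|(1 + \<sigma>)\<close>, while \<open>v\<close>
    contributes \<open>- g|(1 + \<sigma>) = - G + E\<close>.\<close>
  define G where "G a b x y = g a b x y + g b a y x + e a b x y + e b a y x" for a b x y
  \<comment> \<open>Averaging over the central sign change provides the invariance under
    \<open>J\<close>; the equation survives because \<open>C\<close> and \<open>E\<close> are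
    invariant under it.\<close>
  define H where "H a b x y = 1/2 * (G a b x y + G (- a) (- b) (- x) (- y))" for a b x y
  define E where "E a b x y = e a b x y + e b a y x" for a b x y
  have C_eq: "C a b X Y = (if cop N a b then hpoly k (\<lambda>r s. c r s (a mod int N) (b mod int N)) X Y else 0)" for a b X Y
    unfolding C_def by (rule zpart_comb_Zd[OF N])
  have Cl: "C (- a) b (- X) Y = C a b X Y" for a b X Y
  proof (cases "cop N a b")
    case True
    have "hpoly k (\<lambda>r s. c r s (a mod int N) (b mod int N)) X Y =
        hpoly k (\<lambda>r s. (-1) * ((-1) ^ r * c r s ((- a) mod int N) (b mod int N))) X Y"
      using c1[OF _ mod_pairsA[OF N, THEN iffD2, OF True]]
      by (intro hpoly_cong) (simp add: mod_minus_eq)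
    then show ?thesis using True unfolding hpoly_scale hpoly_uminus_left by (simp add: C_eq)
  qed (simp add: C_eq)
  have Cr: "C a (- b) X (- Y) = C a b X Y" for a b X Y
  proof (cases "cop N a b")
    case True
    have "hpoly k (\<lambda>r s. c r s (a mod int N) (b mod int N)) X Y =
        hpoly k (\<lambda>r s. (-1) * ((-1) ^ s * c r s (a mod int N) ((- b) mod int N))) X Y"
      using c2[OF _ mod_pairsA[OF N, THEN iffD2, OF True]]
      by (intro hpoly_cong) (simp add: mod_minus_eq)
    then show ?thesis using True unfolding hpoly_scale hpoly_uminus_right by (simp add: C_eq)
  qed (simp add: C_eq)
  have el: "e (- a) b (- X) Y = - e a b X Y" and er: "e a (- b) X (- Y) = - e a b X Y" for a b X Y
    unfolding e_def by (rule span_evgens_parts[OF y(1)])+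
  have zero: "e a b X Y + ppart k N u a b X Y + g a b X Y = 0" for a b X Y
  proof -
    have "ppart k N (comb k N (Zd N) c) a b X Y = ppart k N (y + (u + v)) a b X Y"
      unfolding uv(1)[symmetric] by simp
    then show ?thesis by (simp add: ppart_linear e_def g_def)
  qed
  have CG: "C a b X Y = G (a + b) b (X + Y) Y - G a b X Y + E a b X Y" for a b X Y
  proof -
    have "C a b X Y = zpart k N (y + (u + v)) a b X Y" unfolding uv(1)[symmetric] by (simp add: C_def)
    then show ?thesis
      unfolding zpart_linear span_evgens_parts(1)[OF y(1)] zpart_span_shrels[OF uv(2)] zpart_span_strels[OF uv(3)]
      using zero[of "a + b" b "X + Y" Y] zero[of b "a + b" Y "X + Y"]
      by (simp add: G_def E_def g_def)
  qed
  have homG: "homog w (G a b)" for a b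
  proof -
    have sw: "homog w (\<lambda>x y. f y x)" if "homog w f" for f
      using homog_linear[OF that, of 0 1 1 0] by simp
    have ge: "homog w (g a b)" "homog w (e a b)" for a b
      unfolding g_def e_def ppart_def k by (rule homog_hpoly)+
    from homog_add[OF homog_add[OF homog_add[OF ge(1)[of a b] sw[OF ge(1)[of b a]]] ge(2)[of a b]]
        sw[OF ge(2)[of b a]]]
    show ?thesis by (simp add: G_def[abs_def])
  qed
  have homH: "homog w (H a b)" for a b
    using homog_scale[OF homog_add[OF homG[of a b] homog_linear[OF homG[of "- a" "- b"], of "-1" 0 0 "-1"]], of "1/2"]
    by (simp add: H_def[abs_def])
  have perH: "H a b = H a' b'" if "same N a b a' b'" for a b a' b'
  proof -
    have mods: "a mod int N = a' mod int N" "b mod int N = b' mod int N"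
      "(- a) mod int N = (- a') mod int N" "(- b) mod int N = (- b') mod int N"
      using that by (auto simp: same_def cong_def intro: mod_minus_cong)
    show ?thesis by (intro ext) (simp add: H_def G_def g_def e_def ppart_def mods)
  qed
  have CE: "C a b X Y = H (a + b) b (X + Y) Y - H a b X Y + E a b X Y" for a b X Y
  proof -
    have "C (- a) (- b) (- X) (- Y) = C a b X Y" by (simp add: Cl Cr)
    moreover have "E (- a) (- b) (- X) (- Y) = E a b X Y" by (simp add: E_def el er)
    ultimately show ?thesis
      using CG[of a b X Y] CG[of "- a" "- b" "- X" "- Y"] by (simp add: H_def algebra_simps)
  qed
  have HJ: "H (- a) (- b) (- x) (- y) = H a b x y" and Hs: "H b a y x = H a b x y" for a b x y
    by (simp_all add: H_def G_def)
  have El: "E (- a) b (- x) y = - E a b x y" and Es: "E b a y x = E a b x y" for a b x y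
    using er[of b a y x] by (simp_all add: E_def el)
  obtain P where P: "P \<in> Wbar_plus (Gamma1 N) w"
    "\<And>a b x y. cop N a b \<Longrightarrow> (qfun N P a b x y + qfun N P (- a) b (- x) y) / 2 = C a b x y"
    using period_from_symmetric[of N w H C E, OF N homH perH HJ Hs CE Cl El Es] by blast
  have Vt: "P \<in> Vtilde (Gamma1 N) w" using P by (simp add: Wbar_plus_iff[OF N])
  have "c r s a b = q_od N P r s a b" if rs: "(r, s) \<in> rs_pairs k" and ab: "(a, b) \<in> pairsA N" for r s a b
  proof (rule hpoly_eqD[OF _ rs])
    fix x y
    have cop: "cop N a b" using ab by (simp add: pairsA_iff)
    show "hpoly k (\<lambda>r s. c r s a b) x y = hpoly k (\<lambda>r s. q_od N P r s a b) x y"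
      using P(2)[OF cop] hpoly_q_od[OF N Vt cop] pairsA_mod[OF ab] by (simp add: C_eq k)
  qed
  then show ?thesis using P(1) by blast
qed

theorem theorem1p3:
  fixes N w k :: nat
  assumes "N \<ge> 1" and "k = w + 2" and "(k, N) \<noteq> (2, 1)"
  shows
    "(\<forall>P \<in> Wbar_plus (Gamma1 N) w.
        (\<forall>(r, s) \<in> rs_pairs k. \<forall>(a, b) \<in> pairsA N.
           q_od N P r s a b = (-1)^(r + 1) * q_od N P r s (- a) b \<and>
           q_od N P r s a b = (-1)^(s + 1) * q_od N P r s a (- b) \<and>
           q_ev N P r s a b = (-1)^r * q_ev N P r s (- a) b \<and>
           q_ev N P r s a b = (-1)^s * q_ev N P r s a (- b) \<and>
           q_ev N P r s a b = q_ev N P s r b a) \<and>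
        dz_class k N
          (dz_scale 3 (\<Sum>(r, s)\<in>rs_pairs k. \<Sum>(a, b)\<in>pairsA N. dz_scale (q_od N P r s a b) (Zd N r s a b)))
        = dz_class k N
          (- (\<Sum>(r, s)\<in>rs_pairs k. \<Sum>(a, b)\<in>pairsA N. dz_scale (q_ev N P r s a b) (Zd N r s a b))
           - (\<Sum>(r, s)\<in>rs_pairs k. \<Sum>(a, b)\<in>pairsA N. dz_scale (qcoeff N P r s a b) (Zs N (r + s) (a + b)))) \<and>
        dz_class k N
          (dz_scale 3 (\<Sum>(r, s)\<in>rs_pairs k. \<Sum>(a, b)\<in>pairsA N. dz_scale (q_od N P r s a b) (Zd N r s a b)))
        \<in> P_ev k N)
     \<and>
     (\<forall>c :: nat \<Rightarrow> nat \<Rightarrow> int \<Rightarrow> int \<Rightarrow> rat.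
        (\<forall>(r, s) \<in> rs_pairs k. \<forall>(a, b) \<in> pairsA N.
           c r s a b = (-1)^(r + 1) * c r s ((- a) mod int N) b \<and>
           c r s a b = (-1)^(s + 1) * c r s a ((- b) mod int N)) \<longrightarrow>
        (dz_class k N
           (\<Sum>(r, s)\<in>rs_pairs k. \<Sum>(a, b)\<in>pairsA N. dz_scale (c r s a b) (Zd N r s a b)) \<in> P_ev k N
         \<longleftrightarrow>
         (\<exists>P \<in> Wbar_plus (Gamma1 N) w. \<forall>(r, s) \<in> rs_pairs k. \<forall>(a, b) \<in> pairsA N.
            c r s a b = q_od N P r s a b)))"
proof -
  have Z: "(\<Sum>(r, s)\<in>rs_pairs k. \<Sum>(a, b)\<in>pairsA N. dz_scale (h r s a b) (Zd N r s a b)) = comb k N (Zd N) h"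
    and Zs: "(\<Sum>(r, s)\<in>rs_pairs k. \<Sum>(a, b)\<in>pairsA N. dz_scale (h r s a b) (Zs N (r + s) (a + b))) = comb k N (Zsum N) h"
    for h by (simp_all add: comb_def Zsum_def)
  note N = assms(1) and k = assms(2)
  note free = comb_free[OF N] dz.subspace_scale[OF subspace_dz_free comb_free(1)[OF N]]
  show ?thesis
    unfolding Z Zs
  proof (intro conjI ballI allI impI)
    fix P assume P: "P \<in> Wbar_plus (Gamma1 N) w"
    show "case p of (r, s) \<Rightarrow> \<forall>(a, b) \<in> pairsA N.
           q_od N P r s a b = (-1)^(r + 1) * q_od N P r s (- a) b \<and>
           q_od N P r s a b = (-1)^(s + 1) * q_od N P r s a (- b) \<and>
           q_ev N P r s a b = (-1)^r * q_ev N P r s (- a) b \<and>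
           q_ev N P r s a b = (-1)^s * q_ev N P r s a (- b) \<and>
           q_ev N P r s a b = q_ev N P s r b a" if "p \<in> rs_pairs k" for p
    proof (cases p)
      case (Pair r s)
      then have "(r, s) \<in> rs_pairs (w + 2)" using that k by simp
      from q_parity[OF N P this] show ?thesis unfolding Pair by (auto simp only: pairsA_iff prod.case)
    qed
    let ?x = "- comb k N (Zd N) (q_ev N P) - comb k N (Zsum N) (qcoeff N P)"
    have "?x \<in> dz_free k N"
      by (intro dz.subspace_diff[OF subspace_dz_free] dz.subspace_neg[OF subspace_dz_free] free)
    moreover have "dz_scale 3 (comb k N (Zd N) (q_od N P)) - ?x \<in> dz.span (dz_relators k N)"
    proof -
      have "dz_scale 3 (comb k N (Zd N) (q_od N P)) - ?x =
          comb k N (shrel N) (qcoeff N P) - comb k N (strel N) (qcoeff N P)"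
        unfolding qcoeff_relation[OF N P k, symmetric] by (simp add: algebra_simps)
      then show ?thesis by (simp only:) (intro dz.span_diff shrels_strels_span)
    qed
    ultimately show "dz_class k N (dz_scale 3 (comb k N (Zd N) (q_od N P))) = dz_class k N ?x"
      by (simp add: dz_class_eq_iff free)
    show "dz_class k N (dz_scale 3 (comb k N (Zd N) (q_od N P))) \<in> P_ev k N"
      using q_od_even_relation[OF N P k] by (simp add: P_ev_iff[OF N] free)
  next
    fix c :: "nat \<Rightarrow> nat \<Rightarrow> int \<Rightarrow> int \<Rightarrow> rat"
    assume c: "\<forall>(r, s) \<in> rs_pairs k. \<forall>(a, b) \<in> pairsA N.
           c r s a b = (-1)^(r + 1) * c r s ((- a) mod int N) b \<and>
           c r s a b = (-1)^(s + 1) * c r s a ((- b) mod int N)"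
    show "dz_class k N (comb k N (Zd N) c) \<in> P_ev k N \<longleftrightarrow>
        (\<exists>P \<in> Wbar_plus (Gamma1 N) w. \<forall>(r, s) \<in> rs_pairs k. \<forall>(a, b) \<in> pairsA N. c r s a b = q_od N P r s a b)"
    proof
      assume "dz_class k N (comb k N (Zd N) c) \<in> P_ev k N"
      then obtain y where "y \<in> dz.span (evgens k N)" "comb k N (Zd N) c - y \<in> dz.span (dz_relators k N)"
        by (auto simp: P_ev_iff[OF N] free)
      then show "\<exists>P \<in> Wbar_plus (Gamma1 N) w. \<forall>(r, s) \<in> rs_pairs k. \<forall>(a, b) \<in> pairsA N. c r s a b = q_od N P r s a b"
        using c by (intro period_of_relation[OF N k]) blast+
    next
      assume "\<exists>P \<in> Wbar_plus (Gamma1 N) w. \<forall>(r, s) \<in> rs_pairs k. \<forall>(a, b) \<in> pairsA N. c r s a b = q_od N P r s a b"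
      then obtain P where P: "P \<in> Wbar_plus (Gamma1 N) w"
        "\<forall>(r, s) \<in> rs_pairs k. \<forall>(a, b) \<in> pairsA N. c r s a b = q_od N P r s a b" by blast
      have "c r s a b = q_od N P r s a b" if "(r, s) \<in> rs_pairs k" "(a, b) \<in> pairsA N" for r s a b
        using P(2) that by blast
      then have cq: "comb k N (Zd N) c = comb k N (Zd N) (q_od N P)"
        unfolding comb_def by (intro sum.cong refl) (auto intro!: sum.cong)
      \<comment> \<open>The even relation is available for three times the odd part, so its witness
        is divided by 3.\<close>
      obtain y where y: "y \<in> dz.span (evgens k N)"
        "dz_scale 3 (comb k N (Zd N) c) - y \<in> dz.span (dz_relators k N)"
        using q_od_even_relation[OF N P(1) k] unfolding cq by blast
      have "comb k N (Zd N) c - dz_scale (1/3) y = dz_scale (1/3) (dz_scale 3 (comb k N (Zd N) c) - y)"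
        by (simp add: dz.scale_right_diff_distrib)
      also have "\<dots> \<in> dz.span (dz_relators k N)" using y(2) by (rule dz.span_scale)
      finally show "dz_class k N (comb k N (Zd N) c) \<in> P_ev k N"
        using dz.span_scale[OF y(1), of "1/3"] by (auto simp: P_ev_iff[OF N] free)
    qed
  qed
qed

end
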